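(* Let $N\geq 2$ and let $p(\theta)=a_0+\sum_{k=1}^{N}(a_k\cos k\theta+b_k\sin k\theta)$ be a real trigonometric polynomial with $a_N\neq 0$ or $b_N\neq 0$. Let $\mathcal{C}\subset\mathbb{R}^2$ be the curve parametrized by $\theta\in[-\pi,\pi]\mapsto \big(p(\theta)\cos\theta-p'(\theta)\sin\theta,\ p(\theta)\sin\theta+p'(\theta)\cos\theta\big)$, and let $f\in\mathbb{R}[x,y]$ be its defining polynomial. (i) If $a_{2k}\neq 0$ for some integer $k$ with $0\le 2k\le N$, or $b_{2k}\neq0$ for some integer $k$ with $2\le 2k\le N$, then $f$ has total degree $2N+2$. (ii) If $a_{2k}=0$ and $b_{2k}=0$ for all integers $k$ with $0\leq 2k\leq N$ (with $b_0:=0$), then $f$ has total degree $N+1$.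
   Context: The defining polynomial of the (irreducible, real algebraic) curve $\mathcal{C}$ is the irreducible polynomial $f\in\mathbb{R}[x,y]$, unique up to multiplication by a nonzero constant, whose zero set is the Zariski closure of $\mathcal{C}$. *)

theory Defs
  imports "HOL-Analysis.Analysis" "HOL-Computational_Algebra.Polynomial"
begin

text \<open>Bivariate real polynomials f in R[x,y] are represented as elements of
  R[x][y], i.e. type real poly poly: f = sum_j (coeff f j)(x) * y^j.\<close>

definition eval2 :: "real poly poly \<Rightarrow> real \<Rightarrow> real \<Rightarrow> real" where
  "eval2 f x y = poly (map_poly (\<lambda>c. poly c x) f) y"

text \<open>Total degree of a bivariate polynomial (0 for the zero polynomial).\<close>
definition total_degree :: "real poly poly \<Rightarrow> nat" where
  "total_degree f = Max (insert 0 {j + degree (coeff f j) | j. coeff f j \<noteq> 0})"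

definition zariski_closure :: "(real \<times> real) set \<Rightarrow> (real \<times> real) set" where
  "zariski_closure S = {(x, y). \<forall>g. (\<forall>(u, v)\<in>S. eval2 g u v = 0) \<longrightarrow> eval2 g x y = 0}"

definition defining_polynomial :: "real poly poly \<Rightarrow> (real \<times> real) set \<Rightarrow> bool" where
  "defining_polynomial f C \<longleftrightarrow>
     irreducible f \<and> {(x, y). eval2 f x y = 0} = zariski_closure C"

definition trig_poly :: "nat \<Rightarrow> (nat \<Rightarrow> real) \<Rightarrow> (nat \<Rightarrow> real) \<Rightarrow> real \<Rightarrow> real" where
  "trig_poly N a b \<theta> = a 0 + (\<Sum>k=1..N. a k * cos (real k * \<theta>) + b k * sin (real k * \<theta>))"

definition curve :: "nat \<Rightarrow> (nat \<Rightarrow> real) \<Rightarrow> (nat \<Rightarrow> real) \<Rightarrow> (real \<times> real) set" where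
  "curve N a b = (\<lambda>\<theta>. let p = trig_poly N a b in
      (p \<theta> * cos \<theta> - deriv p \<theta> * sin \<theta>, p \<theta> * sin \<theta> + deriv p \<theta> * cos \<theta>)) ` {-pi..pi}"

end

theory Submission
  imports Defs "HOL-Computational_Algebra.Polynomial_Factorial" "HOL-Computational_Algebra.Field_as_Ring"
    "HOL-Computational_Algebra.Fundamental_Theorem_Algebra"
begin

text \<open>With \<open>w = exp (\<i>\<theta>)\<close> the parametrization extends to a pair \<open>(X, Y)\<close> of complex Laurent
  polynomials with exponents in \<open>{-(N+1)..N+1}\<close>, and both extreme coefficients of \<open>X\<close> are nonzero
  because \<open>N \<ge> 2\<close>. The pair is even in \<open>w\<close> exactly when all even-index coefficients of \<open>p\<close> vanish.

  Upper bound: \<open>f\<close> divides every polynomial vanishing on the curve, so for large \<open>m\<close> the polynomials of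
  degree at most \<open>m\<close> restrict to a space of dimension \<open>m deg f + O(1)\<close> on the curve. These restrictions
  are Laurent polynomials with exponents up to \<open>m(N+1)\<close>, hence are determined by \<open>2m(N+1) + 1\<close> values,
  and by \<open>m(N+1) + 1\<close> values if they are even.

  Lower bound: for generic \<open>\<gamma>\<close>, the equation \<open>X(w) = \<gamma>\<close> has \<open>2N+2\<close> simple roots. The tangent at \<open>\<theta>\<close> is
  orthogonal to \<open>(cos \<theta>, sin \<theta>)\<close>, so a point with nonzero gradient of \<open>f\<close> determines \<open>w\<^sup>2\<close>. Hence
  \<open>f(\<gamma>, y)\<close> has at least \<open>N+1\<close> roots \<open>y = Y(w)\<close>, and at least \<open>2N+2\<close> if \<open>(X, Y)\<close> is not even.\<close>

section \<open>Evaluation of real bivariate polynomials at real and complex points, and the chain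
  rule\<close>

definition peval :: "real poly poly \<Rightarrow> 'a::real_field \<Rightarrow> 'a \<Rightarrow> 'a" where
  "peval f x y = poly (map_poly (\<lambda>c. poly (map_poly of_real c) x) f) y"

lemma eval2_eq_peval: "eval2 f x y = peval f x y"
  by (simp add: eval2_def peval_def id_def[symmetric])

lemma poly_map_of_real_add:
  "poly (map_poly of_real (c + d)) (x::'a::real_field) = poly (map_poly of_real c) x + poly (map_poly of_real d) x"
  by (subst poly_add[symmetric], rule arg_cong[where f="\<lambda>p. poly p x"])
     (auto simp: poly_eq_iff coeff_map_poly)

lemma poly_map_of_real_mult:
  "poly (map_poly of_real (c * d)) (x::'a::real_field) = poly (map_poly of_real c) x * poly (map_poly of_real d) x"
  by (subst poly_mult[symmetric], rule arg_cong[where f="\<lambda>p. poly p x"])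
     (auto simp: poly_eq_iff coeff_map_poly coeff_mult)

lemma peval_0 [simp]: "peval 0 x y = 0"
  by (simp add: peval_def)

lemma peval_pCons [simp]: "peval (pCons c f) x y = poly (map_poly of_real c) x + y * peval f x y"
  by (simp add: peval_def map_poly_pCons)

lemma peval_add: "peval (f + g) x y = peval f x y + peval g x y"
proof (induction f arbitrary: g)
  case (pCons c f)
  then show ?case
    by (cases g) (auto simp: poly_map_of_real_add algebra_simps)
qed simp

lemma peval_smult: "peval (smult c g) x y = poly (map_poly of_real c) x * peval g x y"
  by (induction g) (auto simp: poly_map_of_real_mult algebra_simps)

lemma peval_mult: "peval (f * g) x y = peval f x y * peval g x y"
  by (induction f) (auto simp: peval_add peval_smult algebra_simps)

lemma peval_sum: "peval (sum f A) x y = (\<Sum>a\<in>A. peval (f a) x y)"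
  by (induction A rule: infinite_finite_induct) (auto simp: peval_add)

lemma peval_monom: "peval (monom (monom c i) j) x y = of_real c * x ^ i * y ^ j"
  by (induction j) (auto simp: monom_0 monom_Suc map_poly_monom poly_monom algebra_simps)

lemma of_real_poly:
  "of_real (poly c x) = poly (map_poly of_real c) (of_real x :: 'a::real_field)"
  by (induction c) (auto simp: map_poly_pCons)

lemma of_real_peval: "of_real (peval f x y) = peval f (of_real x) (of_real y :: 'a::real_field)"
  by (induction f) (auto simp: of_real_poly[symmetric])

lemma has_field_derivative_poly_map_of_real:
  fixes X :: "'a::real_normed_field \<Rightarrow> 'a"
  assumes "(X has_field_derivative X') (at w)"
  shows "((\<lambda>w. poly (map_poly of_real c) (X w)) has_field_derivative
    (poly (map_poly of_real (pderiv c)) (X w) * X')) (at w)"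
proof -
  have "map_poly of_real (pderiv c) = pderiv (map_poly of_real c :: 'a poly)"
    by (auto simp: poly_eq_iff coeff_pderiv coeff_map_poly)
  then show ?thesis
    using DERIV_chain2[OF poly_DERIV assms] by simp
qed

text \<open>\<open>map_poly pderiv f\<close> is the partial derivative in \<open>x\<close>, \<open>pderiv f\<close> the one in \<open>y\<close>.\<close>

lemma has_field_derivative_peval:
  fixes X Y :: "'a::real_normed_field \<Rightarrow> 'a"
  assumes "(X has_field_derivative X') (at w)" "(Y has_field_derivative Y') (at w)"
  shows "((\<lambda>w. peval f (X w) (Y w)) has_field_derivative
    (peval (map_poly pderiv f) (X w) (Y w) * X' + peval (pderiv f) (X w) (Y w) * Y')) (at w)"
proof (induction f)
  case (pCons c f)
  show ?case
    by (rule derivative_eq_intros has_field_derivative_poly_map_of_real assms pCons refl | simp)+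
       (simp add: pderiv_pCons map_poly_pCons peval_add algebra_simps)
qed simp

section \<open>Total degree and leading monomials\<close>

lemma total_degree_set_finite: "finite {j + degree (coeff f j) | j. coeff f j \<noteq> 0}"
proof -
  have "{j + degree (coeff f j) | j. coeff f j \<noteq> 0} \<subseteq> (\<lambda>j. j + degree (coeff f j)) ` {..degree f}"
    by (auto intro: le_degree)
  then show ?thesis
    by (rule finite_subset) auto
qed

lemma le_total_degree: "coeff (coeff f j) i \<noteq> 0 \<Longrightarrow> i + j \<le> total_degree f"
proof -
  assume a: "coeff (coeff f j) i \<noteq> 0"
  then have "coeff f j \<noteq> 0" "i \<le> degree (coeff f j)"
    by (auto intro: le_degree)
  moreover from this have "j + degree (coeff f j) \<le> total_degree f"
    unfolding total_degree_def using total_degree_set_finite by (intro Max_ge) auto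
  ultimately show ?thesis
    by simp
qed

lemma degree_le_total_degree: "degree f \<le> total_degree f"
proof (cases "f = 0")
  case False
  then have "coeff (coeff f (degree f)) (degree (coeff f (degree f))) \<noteq> 0"
    by simp
  from le_total_degree[OF this] show ?thesis by simp
qed simp

lemma total_degree_le:
  assumes "\<And>i j. coeff (coeff f j) i \<noteq> 0 \<Longrightarrow> i + j \<le> m"
  shows "total_degree f \<le> m"
proof -
  have "j + degree (coeff f j) \<le> m" if "coeff f j \<noteq> 0" for j
    using assms[of j "degree (coeff f j)"] that by simp
  then show ?thesis
    unfolding total_degree_def using total_degree_set_finite[of f] by auto
qed

text \<open>The exponent of the leading monomial in the graded order that breaks ties in favour of
  \<open>y\<close>.\<close>

definition leading_exponent :: "real poly poly \<Rightarrow> nat \<Rightarrow> nat \<Rightarrow> bool" where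
  "leading_exponent f i j \<longleftrightarrow> coeff (coeff f j) i \<noteq> 0 \<and>
     (\<forall>i' j'. coeff (coeff f j') i' \<noteq> 0 \<longrightarrow> i' + j' < i + j \<or> i' + j' = i + j \<and> j' \<le> j)"

lemma leading_exponent_exists:
  assumes "f \<noteq> 0"
  shows "\<exists>i j. leading_exponent f i j \<and> i + j = total_degree f"
proof -
  let ?S = "{j + degree (coeff f j) | j. coeff f j \<noteq> 0}"
  have "?S \<noteq> {}"
    using assms by (auto simp: poly_eq_iff)
  then have "total_degree f \<in> ?S"
    unfolding total_degree_def using Max_in[OF total_degree_set_finite[of f]]
    by (simp add: total_degree_set_finite)
  then obtain j0 where j0: "total_degree f = j0 + degree (coeff f j0)" "coeff f j0 \<noteq> 0"
    by auto
  \<comment> \<open>Among the monomials of top total degree, the one with the largest exponent of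
    \<open>y\<close> is the leading one.\<close>
  let ?J = "{j. j \<le> total_degree f \<and> coeff (coeff f j) (total_degree f - j) \<noteq> 0}"
  have fin: "finite ?J" by simp
  have "j0 \<in> ?J"
    using j0 by auto
  then have ne: "?J \<noteq> {}" by blast
  have m: "Max ?J \<in> ?J"
    using Max_in[OF fin ne] .
  have "leading_exponent f (total_degree f - Max ?J) (Max ?J)"
    unfolding leading_exponent_def
  proof (intro conjI allI impI)
    fix i' j' assume c: "coeff (coeff f j') i' \<noteq> 0"
    have "j' \<le> Max ?J" if "i' + j' = total_degree f"
    proof (intro Max_ge fin)
      have "total_degree f - j' = i'" using that by simp
      with that c show "j' \<in> ?J" by auto
    qed
    with le_total_degree[OF c] m
    show "i' + j' < total_degree f - Max ?J + Max ?J \<or>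
        i' + j' = total_degree f - Max ?J + Max ?J \<and> j' \<le> Max ?J"
      by auto
  qed (use m in auto)
  then show ?thesis
    using m by force
qed

text \<open>The order is compatible with multiplication: in the convolution, any other pair of
  monomials would need one factor above its leading exponent.\<close>

lemma leading_coeff2_mult:
  assumes f: "leading_exponent f i j" and g: "leading_exponent g i' j'"
  shows "coeff (coeff (f * g) (j + j')) (i + i') = coeff (coeff f j) i * coeff (coeff g j') i'"
proof -
  let ?t = "\<lambda>(l, k). coeff (coeff f l) k * coeff (coeff g (j + j' - l)) (i + i' - k)"
  have "coeff (coeff (f * g) (j + j')) (i + i') = sum ?t ({..j + j'} \<times> {..i + i'})"
    by (simp add: coeff_mult coeff_sum sum.cartesian_product)
  also have "\<dots> = sum ?t {(j, i)}"
  proof (rule sum.mono_neutral_right)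
    show "\<forall>p \<in> {..j + j'} \<times> {..i + i'} - {(j, i)}. ?t p = 0"
    proof (intro ballI, rule ccontr)
      fix p assume "p \<in> {..j + j'} \<times> {..i + i'} - {(j, i)}" "?t p \<noteq> 0"
      then obtain l k where le: "l \<le> j + j'" "k \<le> i + i'" and ne: "l = j \<longrightarrow> k \<noteq> i"
        and c: "coeff (coeff f l) k \<noteq> 0" "coeff (coeff g (j + j' - l)) (i + i' - k) \<noteq> 0"
        by (cases p) auto
      have "k + l < i + j \<or> k + l = i + j \<and> l \<le> j"
        using f c by (auto simp: leading_exponent_def)
      moreover have "(i + i' - k) + (j + j' - l) < i' + j' \<or>
          (i + i' - k) + (j + j' - l) = i' + j' \<and> j + j' - l \<le> j'"
        using g c by (auto simp: leading_exponent_def)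
      ultimately show False
        using le ne by linarith
    qed
  qed auto
  finally show ?thesis by simp
qed

text \<open>Meant for polynomials without multiples of \<open>x^i y^j\<close> among their monomials:
  apart from 0, none of them is divisible by \<open>f\<close>.\<close>

lemma leading_exponent_dvd:
  assumes "leading_exponent f i j" "f dvd g" "g \<noteq> 0"
  shows "\<exists>k l. i \<le> k \<and> j \<le> l \<and> coeff (coeff g l) k \<noteq> 0"
proof -
  obtain h where h: "g = f * h" using assms(2) by blast
  with assms(3) obtain i' j' where "leading_exponent h i' j'"
    using leading_exponent_exists[of h] by auto
  with leading_coeff2_mult[OF assms(1) this] h assms(1)
  have "coeff (coeff g (j + j')) (i + i') \<noteq> 0"
    by (auto simp: leading_exponent_def)
  then show ?thesis
    by (intro exI[of _ "i + i'"] exI[of _ "j + j'"]) simp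
qed

section \<open>Polynomials vanishing on a curve\<close>

text \<open>A substitute for the resultant: an element \<open>h\<close> of least
  \<open>y\<close>-degree in the ideal of \<open>f\<close> and \<open>g\<close> divides both up to
  nonzero factors in \<open>x\<close>, and primality of \<open>f\<close> forces this degree to be
  0.\<close>

lemma elimination:
  fixes f g :: "real poly poly"
  assumes "irreducible f" "\<not> f dvd g"
  shows "\<exists>u v r. r \<noteq> 0 \<and> u * f + v * g = [:r:]"
proof -
  have p: "prime_elem f" using assms(1) by (rule irreducible_imp_prime_poly)
  let ?P = "\<lambda>h. h \<noteq> 0 \<and> (\<exists>u v. h = u * f + v * g)"
  have "f = 1 * f + 0 * g" by simp
  moreover have "f \<noteq> 0" using assms(1) by auto
  ultimately have "?P f" by blast
  then obtain h where h: "?P h" and min: "\<And>h'. ?P h' \<Longrightarrow> degree h \<le> degree h'"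
    using ex_has_least_nat[of ?P f degree] by blast
  then obtain u v where uv: "h = u * f + v * g" by blast
  \<comment> \<open>The remainder of pseudo-division by \<open>h\<close> stays in the ideal, so
    minimality of \<open>h\<close> makes it 0.\<close>
  have div: "\<exists>c q. c \<noteq> 0 \<and> smult c e = h * q" if e: "e = s * f + t * g" for e s t
  proof -
    obtain c q where cq: "c \<noteq> 0" "smult c e = h * q + pseudo_mod e h"
      using pseudo_mod(1)[of h e] h by blast
    have "pseudo_mod e h = smult c e - h * q"
      using cq by simp
    also have "\<dots> = (smult c s - u * q) * f + (smult c t - v * q) * g"
      unfolding e uv by (simp add: algebra_simps smult_add_right)
    finally have "pseudo_mod e h = 0"
      using min pseudo_mod(2)[of h e] h by (meson not_less)
    with cq show ?thesis by auto
  qed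
  have "degree h = 0"
  proof -
    obtain c q where cq: "c \<noteq> 0" "smult c f = h * q"
      using div[of f 1 0] by auto
    have "f dvd h * q"
      using cq(2) by (metis dvd_smult dvd_refl)
    \<comment> \<open>In the first case, cancelling \<open>f\<close> leaves \<open>h\<close> as a
      factor of \<open>[:c:]\<close>. In the second, \<open>f\<close> divides a multiple
      \<open>[:c':] * g\<close>, hence \<open>[:c':]\<close>, and so has degree 0 in
      \<open>y\<close> itself.\<close>
    then consider "f dvd q" | "f dvd h"
      using p prime_elem_dvd_mult_iff by blast
    then show ?thesis
    proof cases
      case 1
      then obtain q' where "q = f * q'" by blast
      with cq(2) have "f * [:c:] = f * (h * q')" by (simp add: mult_ac)
      with \<open>f \<noteq> 0\<close> have "[:c:] = h * q'" by (metis mult_left_cancel)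
      then show ?thesis
        using cq(1) degree_mult_eq[of h q'] h
        by (metis add_is_0 degree_pCons_0 mult_zero_right pCons_eq_0_iff)
    next
      case 2
      obtain c' q' where cq': "c' \<noteq> 0" "smult c' g = h * q'"
        using div[of g 0 1] by auto
      with 2 have "f dvd [:c':] * g" by simp
      then have "f dvd [:c':]"
        using p assms(2) prime_elem_dvd_mult_iff by blast
      then have "degree f = 0"
        using cq'(1) by (metis degree_pCons_0 dvd_imp_degree_le le_zero_eq pCons_eq_0_iff)
      then show ?thesis using min[OF \<open>?P f\<close>] by simp
    qed
  qed
  then obtain r where "h = [:r:]" by (rule degree_eq_zeroE)
  then show ?thesis
    using h uv by (metis pCons_0_0)
qed

text \<open>Otherwise \<open>elimination\<close> gives a nonzero polynomial in \<open>x\<close>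
  alone that vanishes at infinitely many abscissae.\<close>

lemma irreducible_dvd_if_vanishing:
  assumes irr: "irreducible f" and f: "\<forall>(x, y)\<in>C. eval2 f x y = 0"
    and inf: "infinite (fst ` C)" and g: "\<forall>(x, y)\<in>C. eval2 g x y = 0"
  shows "f dvd g"
proof (rule ccontr)
  assume "\<not> f dvd g"
  then obtain u v r where r: "r \<noteq> 0" "u * f + v * g = [:r:]"
    using elimination[OF irr] by blast
  have "poly r x = 0" if "(x, y) \<in> C" for x y
  proof -
    have "poly r x = eval2 (u * f + v * g) x y"
      by (simp add: r eval2_def map_poly_pCons)
    also have "\<dots> = 0"
      using bspec[OF f that] bspec[OF g that] by (simp add: eval2_eq_peval peval_add peval_mult)
    finally show ?thesis .
  qed
  then have "fst ` C \<subseteq> {x. poly r x = 0}" by auto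
  with inf poly_roots_finite[OF r(1)] show False
    using finite_subset by blast
qed

text \<open>Gaussian elimination by induction on the equations: one with a nonzero coefficient at
  \<open>k\<close> is solved for the unknown \<open>k\<close> and substituted into the rest.\<close>

lemma homogeneous_system_nontrivial:
  fixes M :: "'e \<Rightarrow> 'i \<Rightarrow> 'a::field"
  assumes "finite E" "finite I" "card E < card I"
  shows "\<exists>c. (\<exists>i\<in>I. c i \<noteq> 0) \<and> (\<forall>e\<in>E. (\<Sum>i\<in>I. M e i * c i) = 0)"
  using assms
proof (induction E arbitrary: M I rule: finite_induct)
  case empty
  then have "I \<noteq> {}" by auto
  then show ?case by (intro exI[of _ "\<lambda>_. 1"]) auto
next
  case (insert e E)
  show ?case
  proof (cases "\<forall>i\<in>I. M e i = 0")
    case True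
    have "card E < card I" using insert by simp
    from insert.IH[OF insert.prems(1) this, of M] True show ?thesis by auto
  next
    case False
    then obtain k where k: "k \<in> I" "M e k \<noteq> 0" by blast
    let ?I = "I - {k}"
    let ?M = "\<lambda>e' i. M e' i - M e' k * M e i / M e k"
    have "card E < card ?I" using insert k by simp
    then obtain c where c: "\<exists>i\<in>?I. c i \<noteq> 0" "\<forall>e'\<in>E. (\<Sum>i\<in>?I. ?M e' i * c i) = 0"
      using insert.IH[of ?I ?M] insert.prems by auto
    define c' where "c' = c(k := - (\<Sum>i\<in>?I. M e i * c i) / M e k)"
    have split: "(\<Sum>i\<in>I. M e' i * c' i) = M e' k * c' k + (\<Sum>i\<in>?I. M e' i * c i)" for e'
    proof -
      have "(\<Sum>i\<in>?I. M e' i * c' i) = (\<Sum>i\<in>?I. M e' i * c i)"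
        by (intro sum.cong) (auto simp: c'_def)
      then show ?thesis
        using sum.remove[OF insert.prems(1) k(1), of "\<lambda>i. M e' i * c' i"] by simp
    qed
    have "(\<Sum>i\<in>I. M e' i * c' i) = 0" if e': "e' \<in> E" for e'
    proof -
      have "0 = (\<Sum>i\<in>?I. M e' i * c i - M e' k / M e k * (M e i * c i))"
        using c(2) e' by (auto simp: algebra_simps)
      also have "\<dots> = (\<Sum>i\<in>?I. M e' i * c i) - M e' k / M e k * (\<Sum>i\<in>?I. M e i * c i)"
        by (simp add: sum_subtractf sum_distrib_left)
      finally show ?thesis
        unfolding split by (simp add: c'_def)
    qed
    moreover have "(\<Sum>i\<in>I. M e i * c' i) = 0"
      unfolding split using k by (simp add: c'_def)
    moreover have "\<exists>i\<in>I. c' i \<noteq> 0"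
      using c(1) by (auto simp: c'_def)
    ultimately show ?thesis by (intro exI[of _ c']) auto
  qed
qed

text \<open>\<open>S\<close> collects the monomials of degree at most \<open>m\<close> that are not
  multiples of \<open>x^i y^j\<close>. This staircase contains two disjoint rectangles of length
  \<open>m + 1 - (i + j)\<close> and of widths \<open>i\<close> and \<open>j\<close>.\<close>

lemma card_standard_exponents:
  fixes i j m :: nat
  assumes "i + j \<le> m"
  defines "S \<equiv> {(k, l). k + l \<le> m \<and> \<not> (i \<le> k \<and> j \<le> l)}"
  shows "finite S" "(i + j) * (m + 1 - (i + j)) \<le> card S"
proof -
  have "S \<subseteq> {..m} \<times> {..m}" by (auto simp: S_def)
  then show fin: "finite S" by (rule finite_subset) auto
  define n where "n = m + 1 - (i + j)"
  let ?A = "{..<i} \<times> {..<n}" and ?B = "{i..<i + n} \<times> {..<j}"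
  have "(i + j) * n = card ?A + card ?B"
    by (simp add: algebra_simps)
  also have "\<dots> = card (?A \<union> ?B)"
    by (rule card_Un_disjoint[symmetric]) auto
  also have "\<dots> \<le> card S"
    using assms(1) by (intro card_mono fin) (auto simp: S_def n_def)
  finally show "(i + j) * (m + 1 - (i + j)) \<le> card S"
    by (simp only: n_def)
qed

text \<open>Modulo \<open>f\<close>, the polynomials of degree at most \<open>m\<close> form a space of dimension
  \<open>m * total_degree f + O(1)\<close>; if \<open>D * m + 1\<close> points suffice to detect them, then
  \<open>total_degree f \<le> D\<close>.\<close>

lemma total_degree_le_if_sampling:
  assumes irr: "irreducible f" and f: "\<forall>(x, y)\<in>C. eval2 f x y = 0"
    and inf: "infinite (fst ` C)"
    and sampling: "\<And>m. \<exists>W. finite W \<and> card W \<le> D * m + 1 \<and>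
      (\<forall>g. total_degree g \<le> m \<longrightarrow> (\<forall>(x, y)\<in>W. eval2 g x y = 0) \<longrightarrow>
         (\<forall>(x, y)\<in>C. eval2 g x y = 0))"
  shows "total_degree f \<le> D"
proof (rule ccontr)
  assume neg: "\<not> total_degree f \<le> D"
  define d where "d = total_degree f"
  have d: "d \<ge> D + 1" using neg by (simp add: d_def)
  have "f \<noteq> 0" using irr by auto
  then obtain i j where ij: "leading_exponent f i j" "i + j = d"
    using leading_exponent_exists d_def by blast
  \<comment> \<open>Large enough for \<open>d * (m + 1 - d) > D * m + 1\<close>: as
    \<open>D \<le> d - 1\<close>, it suffices that \<open>m > d * d - d + 1\<close>.\<close>
  define m where "m = d * d + 2"
  define S where "S = {(k, l). k + l \<le> m \<and> \<not> (i \<le> k \<and> j \<le> l)}"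
  have dm: "d \<le> m" unfolding m_def using le_square[of d] by linarith
  have S: "finite S" "d * (m + 1 - d) \<le> card S"
    using card_standard_exponents[of i j m] ij dm by (auto simp: S_def)
  obtain W where W: "finite W" "card W \<le> D * m + 1"
    "\<And>g. total_degree g \<le> m \<Longrightarrow> (\<forall>(x, y)\<in>W. eval2 g x y = 0) \<Longrightarrow>
         (\<forall>(x, y)\<in>C. eval2 g x y = 0)"
    using sampling[of m] by metis
  have "d * (m + 1 - d) > D * m + 1"
  proof -
    obtain e where e: "m = d + e" using dm le_Suc_ex by blast
    have "d + e = d * d + 2" using e m_def by simp
    obtain r where r: "d = D + 1 + r" using d le_Suc_ex by blast
    have "int (D * m + 1) \<le> int ((d - 1) * m + 1)"
      using d by (simp add: r algebra_simps)
    also have "\<dots> = (int d - 1) * (int d + int e) + 1"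
      using d by (simp add: e of_nat_diff)
    also have "\<dots> = int d * (int e + 1) + (int d * int d - 2 * int d - int e + 1)"
      by (simp add: algebra_simps)
    also have "\<dots> < int d * (int e + 1)"
    proof -
      have "int d + int e = int d * int d + 2"
        using \<open>d + e = d * d + 2\<close> by (metis of_nat_add of_nat_mult of_nat_numeral)
      then show ?thesis using d by simp
    qed
    also have "\<dots> = int (d * (m + 1 - d))"
      by (simp add: e algebra_simps)
    finally show ?thesis by linarith
  qed
  \<comment> \<open>There are more standard monomials than sample points, so a nonzero combination
    \<open>g\<close> of them vanishes on \<open>W\<close>, hence on \<open>C\<close>. It is then a
    multiple of \<open>f\<close> without any multiple of the leading monomial of
    \<open>f\<close>.\<close>
  then have "card W < card S" using S W by linarith
  then obtain c where c: "\<exists>p\<in>S. c p \<noteq> 0"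
    "\<forall>w\<in>W. (\<Sum>p\<in>S. (fst w ^ fst p * snd w ^ snd p) * c p) = (0::real)"
    using homogeneous_system_nontrivial[OF W(1) S(1), of "\<lambda>w p. fst w ^ fst p * snd w ^ snd p"]
    by blast
  define g where "g = (\<Sum>p\<in>S. monom (monom (c p) (fst p)) (snd p))"
  have coeff_g: "coeff (coeff g l) k = (if (k, l) \<in> S then c (k, l) else 0)" for k l
  proof -
    have "coeff (coeff g l) k = (\<Sum>p\<in>S. if p = (k, l) then c p else 0)"
      unfolding g_def coeff_sum by (intro sum.cong) (auto simp: coeff_monom)
    then show ?thesis using S(1) by (simp add: sum.delta)
  qed
  have "total_degree g \<le> m"
    by (rule total_degree_le) (auto simp: coeff_g S_def split: if_splits)
  moreover have "\<forall>(x, y)\<in>W. eval2 g x y = 0"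
    using c(2) by (auto simp: eval2_eq_peval g_def peval_sum peval_monom mult_ac)
  ultimately have "f dvd g"
    using W(3) irreducible_dvd_if_vanishing[OF irr f inf] by blast
  moreover have "g \<noteq> 0"
    using c(1) coeff_g by (metis coeff_0 surj_pair)
  ultimately obtain k l where "i \<le> k" "j \<le> l" "coeff (coeff g l) k \<noteq> 0"
    using leading_exponent_dvd[OF ij(1)] by blast
  then show False by (auto simp: coeff_g S_def split: if_splits)
qed

section \<open>Laurent polynomials\<close>

text \<open>\<open>h\<close> is a Laurent polynomial with exponents in \<open>{-K..K}\<close>, with coefficient \<open>\<alpha>\<close> at \<open>K\<close>
  and \<open>\<beta>\<close> at \<open>-K\<close>.\<close>

definition laurent_ends :: "nat \<Rightarrow> complex \<Rightarrow> complex \<Rightarrow> (complex \<Rightarrow> complex) \<Rightarrow> bool" where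
  "laurent_ends K \<alpha> \<beta> h \<longleftrightarrow> (\<exists>H. degree H \<le> 2 * K \<and> coeff H (2 * K) = \<alpha> \<and> coeff H 0 = \<beta> \<and>
     (\<forall>w. w \<noteq> 0 \<longrightarrow> w ^ K * h w = poly H w))"

definition laurent :: "nat \<Rightarrow> (complex \<Rightarrow> complex) \<Rightarrow> bool" where
  "laurent K h \<longleftrightarrow> (\<exists>H. degree H \<le> 2 * K \<and> (\<forall>w. w \<noteq> 0 \<longrightarrow> w ^ K * h w = poly H w))"

lemma laurent_iff_ends: "laurent K h \<longleftrightarrow> (\<exists>\<alpha> \<beta>. laurent_ends K \<alpha> \<beta> h)"
  by (auto simp: laurent_def laurent_ends_def)

lemma laurent_ends_imp_laurent: "laurent_ends K \<alpha> \<beta> h \<Longrightarrow> laurent K h"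
  by (auto simp: laurent_iff_ends)

lemma laurent_ends_add:
  assumes "laurent_ends K \<alpha> \<beta> h" "laurent_ends K \<alpha>' \<beta>' h'"
  shows "laurent_ends K (\<alpha> + \<alpha>') (\<beta> + \<beta>') (\<lambda>w. h w + h' w)"
proof -
  obtain H H' where "degree H \<le> 2 * K" "coeff H (2 * K) = \<alpha>" "coeff H 0 = \<beta>"
      "\<forall>w. w \<noteq> 0 \<longrightarrow> w ^ K * h w = poly H w"
      "degree H' \<le> 2 * K" "coeff H' (2 * K) = \<alpha>'" "coeff H' 0 = \<beta>'"
      "\<forall>w. w \<noteq> 0 \<longrightarrow> w ^ K * h' w = poly H' w"
    using assms by (auto simp: laurent_ends_def)
  then show ?thesis
    unfolding laurent_ends_def
    by (intro exI[of _ "H + H'"]) (auto intro: degree_add_le simp: algebra_simps)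
qed

lemma laurent_ends_mult:
  assumes "laurent_ends K \<alpha> \<beta> h" "laurent_ends K' \<alpha>' \<beta>' h'"
  shows "laurent_ends (K + K') (\<alpha> * \<alpha>') (\<beta> * \<beta>') (\<lambda>w. h w * h' w)"
proof -
  obtain H H' where H: "degree H \<le> 2 * K" "coeff H (2 * K) = \<alpha>" "coeff H 0 = \<beta>"
      "\<forall>w. w \<noteq> 0 \<longrightarrow> w ^ K * h w = poly H w"
    and H': "degree H' \<le> 2 * K'" "coeff H' (2 * K') = \<alpha>'" "coeff H' 0 = \<beta>'"
      "\<forall>w. w \<noteq> 0 \<longrightarrow> w ^ K' * h' w = poly H' w"
    using assms by (auto simp: laurent_ends_def)
  have "degree (H * H') \<le> 2 * (K + K')"
    using degree_mult_le[of H H'] H(1) H'(1) by simp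
  moreover have "coeff (H * H') (2 * (K + K')) = \<alpha> * \<alpha>'"
  proof -
    have "coeff (H * H') (2 * (K + K')) = (\<Sum>i\<le>2 * (K + K'). coeff H i * coeff H' (2 * (K + K') - i))"
      by (rule coeff_mult)
    also have "\<dots> = (\<Sum>i\<in>{2 * K}. coeff H i * coeff H' (2 * (K + K') - i))"
    proof (rule sum.mono_neutral_right)
      show "\<forall>i\<in>{..2 * (K + K')} - {2 * K}. coeff H i * coeff H' (2 * (K + K') - i) = 0"
      proof
        fix i assume "i \<in> {..2 * (K + K')} - {2 * K}"
        then consider "i > 2 * K" | "2 * (K + K') - i > 2 * K'" by fastforce
        then show "coeff H i * coeff H' (2 * (K + K') - i) = 0"
        proof cases
          case 1
          then have "coeff H i = 0" using H(1) by (intro coeff_eq_0) simp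
          then show ?thesis by simp
        next
          case 2
          then have "coeff H' (2 * (K + K') - i) = 0" using H'(1) by (intro coeff_eq_0) simp
          then show ?thesis by simp
        qed
      qed
    qed auto
    finally show ?thesis using H H' by simp
  qed
  moreover have "coeff (H * H') 0 = \<beta> * \<beta>'"
    using H H' by (simp add: coeff_mult)
  moreover have "\<forall>w. w \<noteq> 0 \<longrightarrow> w ^ (K + K') * (h w * h' w) = poly (H * H') w"
    by (simp add: power_add H(4)[rule_format, symmetric] H'(4)[rule_format, symmetric] mult_ac)
  ultimately show ?thesis
    unfolding laurent_ends_def by blast
qed

lemma laurent_ends_cmult:
  assumes "laurent_ends K \<alpha> \<beta> h"
  shows "laurent_ends K (c * \<alpha>) (c * \<beta>) (\<lambda>w. c * h w)"
proof -
  have "laurent_ends 0 c c (\<lambda>_. c)"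
    unfolding laurent_ends_def by (intro exI[of _ "[:c:]"]) auto
  from laurent_ends_mult[OF this assms] show ?thesis by simp
qed

lemma laurent_ends_diff:
  assumes "laurent_ends K \<alpha> \<beta> h" "laurent_ends K \<alpha>' \<beta>' h'"
  shows "laurent_ends K (\<alpha> - \<alpha>') (\<beta> - \<beta>') (\<lambda>w. h w - h' w)"
  using laurent_ends_add[OF assms(1) laurent_ends_cmult[OF assms(2), of "-1"]] by simp

text \<open>Multiplying the numerator by \<open>w\<close> widens the exponent range, so terms of
  lower order can be added without changing the end coefficients.\<close>

lemma laurent_ends_Suc:
  assumes "laurent K h"
  shows "laurent_ends (Suc K) 0 0 h"
proof -
  obtain H where H: "degree H \<le> 2 * K" "\<forall>w. w \<noteq> 0 \<longrightarrow> w ^ K * h w = poly H w"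
    using assms by (auto simp: laurent_def)
  have "degree (pCons 0 H) \<le> 2 * Suc K"
    using degree_pCons_le[of 0 H] H(1) by simp
  moreover have "coeff (pCons 0 H) (2 * Suc K) = 0"
    using H(1) by (auto simp: coeff_pCons intro: coeff_eq_0)
  ultimately show ?thesis
    unfolding laurent_ends_def
    using H(2) by (intro exI[of _ "pCons 0 H"]) (auto simp: mult.assoc)
qed

lemma laurent_add: "laurent K h \<Longrightarrow> laurent K h' \<Longrightarrow> laurent K (\<lambda>w. h w + h' w)"
  unfolding laurent_iff_ends by (elim exE, intro exI, rule laurent_ends_add)

lemma laurent_diff: "laurent K h \<Longrightarrow> laurent K h' \<Longrightarrow> laurent K (\<lambda>w. h w - h' w)"
  unfolding laurent_iff_ends by (elim exE, intro exI, rule laurent_ends_diff)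

lemma laurent_mult: "laurent K h \<Longrightarrow> laurent K' h' \<Longrightarrow> laurent (K + K') (\<lambda>w. h w * h' w)"
  unfolding laurent_iff_ends by (elim exE, intro exI, rule laurent_ends_mult)

lemma laurent_cmult: "laurent K h \<Longrightarrow> laurent K (\<lambda>w. c * h w)"
  unfolding laurent_iff_ends by (elim exE, intro exI, rule laurent_ends_cmult)

lemma laurent_mono:
  assumes "laurent K h" "K \<le> K'"
  shows "laurent K' h"
  using assms(2,1) by (induction rule: dec_induct) (auto intro: laurent_ends_imp_laurent laurent_ends_Suc)

lemma laurent_const: "laurent K (\<lambda>_. c)"
proof -
  have "laurent 0 (\<lambda>_. c)"
    unfolding laurent_def by (intro exI[of _ "[:c:]"]) auto
  then show ?thesis by (rule laurent_mono) simp
qed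

lemma laurent_power: "laurent K h \<Longrightarrow> laurent (n * K) (\<lambda>w. h w ^ n)"
  by (induction n) (auto intro: laurent_const laurent_mult)

lemma laurent_sum:
  "(\<And>a. a \<in> A \<Longrightarrow> laurent K (h a)) \<Longrightarrow> laurent K (\<lambda>w. \<Sum>a\<in>A. h a w)"
  by (induction A rule: infinite_finite_induct) (auto intro: laurent_const laurent_add)

lemma laurent_uminus_arg:
  assumes "laurent K h"
  shows "laurent K (\<lambda>w. h (- w))"
proof -
  obtain H where H: "degree H \<le> 2 * K" "\<forall>w. w \<noteq> 0 \<longrightarrow> w ^ K * h w = poly H w"
    using assms by (auto simp: laurent_def)
  have "w ^ K * h (- w) = poly (smult ((-1) ^ K) (pcompose H [:0, -1:])) w" if "w \<noteq> 0" for w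
  proof -
    have "w ^ K = (-1) ^ K * (- w) ^ K"
      by (simp add: power_mult_distrib[symmetric])
    then show ?thesis
      using H(2)[rule_format, of "- w"] that by (simp add: poly_pcompose mult.assoc)
  qed
  then show ?thesis
    unfolding laurent_def
    using H(1) by (intro exI[of _ "smult ((-1) ^ K) (pcompose H [:0, -1:])"]) (auto simp: degree_pcompose)
qed

text \<open>The numerator \<open>H\<close> has degree at most \<open>2 * K\<close>, so more than
  \<open>2 * K\<close> zeros make it vanish identically.\<close>

lemma laurent_eq_0I:
  assumes "laurent K h" "finite V" "card V > 2 * K" "\<And>w. w \<in> V \<Longrightarrow> w \<noteq> 0 \<and> h w = 0" "w \<noteq> 0"
  shows "h w = 0"
proof -
  obtain H where H: "degree H \<le> 2 * K" "\<forall>w. w \<noteq> 0 \<longrightarrow> w ^ K * h w = poly H w"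
    using assms by (auto simp: laurent_def)
  have "H = 0"
  proof (rule ccontr)
    assume nz: "H \<noteq> 0"
    have "poly H v = 0" if "v \<in> V" for v
      using H(2)[rule_format, of v] assms(4)[OF that] by simp
    then have "card V \<le> card {v. poly H v = 0}"
      using poly_roots_finite[OF nz] by (intro card_mono) auto
    also have "\<dots> \<le> degree H" by (rule card_poly_roots_bound[OF nz])
    finally show False using H(1) assms(3) by simp
  qed
  then show ?thesis using H(2) assms(5) by auto
qed

lemma laurent_eq_0I_infinite:
  assumes "laurent K h" "infinite {w. w \<noteq> 0 \<and> h w = 0}" "w \<noteq> 0"
  shows "h w = 0"
proof -
  obtain V where "V \<subseteq> {w. w \<noteq> 0 \<and> h w = 0}" "finite V" "card V = 2 * K + 1"
    using infinite_arbitrarily_large[OF assms(2)] by metis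
  then show ?thesis
    using laurent_eq_0I[OF assms(1), of V w] assms(3) by auto
qed

lemma laurent_ends_eq_0:
  assumes "laurent_ends K \<alpha> \<beta> h" "\<And>w. w \<noteq> 0 \<Longrightarrow> h w = 0"
  shows "\<alpha> = 0" "\<beta> = 0"
proof -
  obtain H where H: "coeff H (2 * K) = \<alpha>" "coeff H 0 = \<beta>"
      "\<forall>w. w \<noteq> 0 \<longrightarrow> w ^ K * h w = poly H w"
    using assms by (auto simp: laurent_ends_def)
  have "UNIV - {0} \<subseteq> {w. poly H w = 0}"
    using H(3) assms(2) by auto
  moreover have "infinite (UNIV - {0 :: complex})"
    by (simp add: infinite_UNIV_char_0)
  ultimately have "H = 0"
    using poly_roots_finite finite_subset by blast
  then show "\<alpha> = 0" "\<beta> = 0" using H by auto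
qed

lemma laurent_ends_finite_zeros:
  assumes "laurent_ends K \<alpha> \<beta> h" "\<alpha> \<noteq> 0"
  shows "finite {w. w \<noteq> 0 \<and> h w = 0}"
  using laurent_eq_0I_infinite[OF laurent_ends_imp_laurent[OF assms(1)]]
    laurent_ends_eq_0(1)[OF assms(1)] assms(2) by blast

lemma peval_sum_monoms:
  "peval g x y = (\<Sum>j\<le>degree g. \<Sum>i\<le>degree (coeff g j). of_real (coeff (coeff g j) i) * x ^ i * y ^ j)"
proof -
  have *: "monom c j = (\<Sum>i\<le>degree c. monom (monom (coeff c i) i) j)" for c :: "real poly" and j
  proof -
    have "monom (sum h A) j = (\<Sum>i\<in>A. monom (h i) j)" for h :: "nat \<Rightarrow> real poly" and A
      by (induction A rule: infinite_finite_induct) (auto simp: add_monom[symmetric])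
    from this[of "\<lambda>i. monom (coeff c i) i" "{..degree c}"] show ?thesis
      by (simp add: poly_as_sum_of_monoms)
  qed
  have "g = (\<Sum>j\<le>degree g. \<Sum>i\<le>degree (coeff g j). monom (monom (coeff (coeff g j) i) i) j)"
    by (simp add: *[symmetric] poly_as_sum_of_monoms)
  then show ?thesis
    by (metis (no_types, lifting) peval_sum peval_monom sum.cong)
qed

text \<open>Each monomial of degree at most \<open>m\<close> in \<open>X\<close> and
  \<open>Y\<close> has exponents of \<open>w\<close> between \<open>- m * K\<close> and
  \<open>m * K\<close>.\<close>

lemma laurent_peval:
  assumes "laurent K X" "laurent K Y" "total_degree g \<le> m"
  shows "laurent (m * K) (\<lambda>w. peval g (X w) (Y w))"
  unfolding peval_sum_monoms
proof (intro laurent_sum)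
  fix i j
  show "laurent (m * K) (\<lambda>w. of_real (coeff (coeff g j) i) * X w ^ i * Y w ^ j)"
  proof (cases "coeff (coeff g j) i = 0")
    case True
    then show ?thesis by (simp add: laurent_const)
  next
    case False
    then have "i + j \<le> m" using le_total_degree assms(3) by (meson le_trans)
    then have "i * K + j * K \<le> m * K"
      by (metis add_mult_distrib mult_le_mono1)
    moreover have "laurent (i * K + j * K) (\<lambda>w. of_real (coeff (coeff g j) i) * X w ^ i * Y w ^ j)"
      by (intro laurent_mult laurent_cmult laurent_power assms)
    ultimately show ?thesis by (rule laurent_mono[rotated])
  qed
qed

section \<open>The parametrization in the variable \<open>w = exp (\<i>\<theta>)\<close>\<close>

text \<open>\<open>lcos\<close> and \<open>lsin\<close> continue \<open>cos (k * \<theta>)\<close>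
  and \<open>sin (k * \<theta>)\<close> analytically from \<open>w = cis \<theta>\<close> to all
  nonzero \<open>w\<close>.\<close>

definition lcos :: "nat \<Rightarrow> complex \<Rightarrow> complex" where
  "lcos k w = (w ^ k + inverse w ^ k) / 2"

definition lsin :: "nat \<Rightarrow> complex \<Rightarrow> complex" where
  "lsin k w = (w ^ k - inverse w ^ k) / (2 * \<i>)"

definition ltrig :: "nat \<Rightarrow> (nat \<Rightarrow> real) \<Rightarrow> (nat \<Rightarrow> real) \<Rightarrow> complex \<Rightarrow> complex" where
  "ltrig N a b w = of_real (a 0) + (\<Sum>k=1..N. of_real (a k) * lcos k w + of_real (b k) * lsin k w)"

text \<open>The derivative of a trigonometric polynomial has cosine coefficients
  \<open>dcos b\<close> and sine coefficients \<open>dsin a\<close>; its constant term is right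
  because \<open>dcos b 0 = 0\<close>.\<close>

abbreviation dcos :: "(nat \<Rightarrow> real) \<Rightarrow> nat \<Rightarrow> real" where
  "dcos b \<equiv> \<lambda>k. real k * b k"

abbreviation dsin :: "(nat \<Rightarrow> real) \<Rightarrow> nat \<Rightarrow> real" where
  "dsin a \<equiv> \<lambda>k. - real k * a k"

lemma lcos_cis: "lcos k (cis \<theta>) = of_real (cos (real k * \<theta>))"
  by (simp add: lcos_def cis_inverse Complex.DeMoivre complex_eq_iff )

lemma lsin_cis: "lsin k (cis \<theta>) = of_real (sin (real k * \<theta>))"
  by (simp add: lsin_def cis_inverse Complex.DeMoivre complex_eq_iff Re_divide Im_divide power2_eq_square)

lemma ltrig_cis: "ltrig N a b (cis \<theta>) = of_real (trig_poly N a b \<theta>)"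
  by (simp add: ltrig_def trig_poly_def lcos_cis lsin_cis)

lemma deriv_trig_poly: "deriv (trig_poly N a b) = trig_poly N (dcos b) (dsin a)"
proof
  fix \<theta>
  have "((\<lambda>\<theta>. trig_poly N a b \<theta>) has_real_derivative trig_poly N (dcos b) (dsin a) \<theta>) (at \<theta>)"
    unfolding trig_poly_def
    by (rule derivative_eq_intros refl)+ (auto intro!: sum.cong)
  then show "deriv (trig_poly N a b) \<theta> = trig_poly N (dcos b) (dsin a) \<theta>"
    by (rule DERIV_imp_deriv)
qed

lemma power_has_derivative:
  fixes w :: complex
  assumes "w \<noteq> 0"
  shows "((\<lambda>w. w ^ k) has_field_derivative of_nat k * w ^ k / w) (at w)"
proof (cases k)
  case (Suc n)
  show ?thesis
    using DERIV_power[OF DERIV_ident, of k w UNIV] assms by (simp add: Suc field_simps)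
qed simp

lemma inverse_power_has_derivative:
  fixes w :: complex
  assumes "w \<noteq> 0"
  shows "((\<lambda>w. inverse w ^ k) has_field_derivative - (of_nat k * inverse w ^ k / w)) (at w)"
proof -
  have "((\<lambda>w. inverse w ^ k) has_field_derivative
      (of_nat k * inverse w ^ k / inverse w) * - (inverse w ^ Suc (Suc 0))) (at w)"
    by (rule DERIV_chain2[OF power_has_derivative DERIV_inverse]) (use assms in auto)
  then show ?thesis
    using assms by (simp add: field_simps)
qed

lemma lcos_has_derivative:
  assumes "w \<noteq> 0"
  shows "(lcos k has_field_derivative - of_nat k * lsin k w / (\<i> * w)) (at w)"
proof -
  have "(n * A / w + - (n * B / w)) / 2 = - n * ((A - B) / (2 * \<i>)) / (\<i> * w)" for n A B :: complex
    using assms by (simp add: field_simps)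
  with DERIV_cdivide[OF DERIV_add[OF power_has_derivative[OF assms] inverse_power_has_derivative[OF assms]],
      of k k 2]
  show ?thesis
    unfolding lcos_def[abs_def] lsin_def by metis
qed

lemma lsin_has_derivative:
  assumes "w \<noteq> 0"
  shows "(lsin k has_field_derivative of_nat k * lcos k w / (\<i> * w)) (at w)"
proof -
  have "(n * A / w - - (n * B / w)) / (2 * \<i>) = n * ((A + B) / 2) / (\<i> * w)" for n A B :: complex
    using assms by (simp add: field_simps)
  with DERIV_cdivide[OF DERIV_diff[OF power_has_derivative[OF assms] inverse_power_has_derivative[OF assms]],
      of k k "2 * \<i>"]
  show ?thesis
    unfolding lsin_def[abs_def] lcos_def by metis
qed

text \<open>The factor \<open>1 / (\<i> * w)\<close> is \<open>d\<theta> / dw\<close> for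
  \<open>w = exp (\<i> * \<theta>)\<close>.\<close>

lemma ltrig_has_derivative:
  assumes "w \<noteq> 0"
  shows "(ltrig N a b has_field_derivative ltrig N (dcos b) (dsin a) w / (\<i> * w)) (at w)"
proof -
  have "((\<lambda>w. of_real (a 0) + (\<Sum>k=1..N. of_real (a k) * lcos k w + of_real (b k) * lsin k w))
      has_field_derivative (\<Sum>k=1..N. of_real (a k) * (- of_nat k * lsin k w / (\<i> * w)) +
         of_real (b k) * (of_nat k * lcos k w / (\<i> * w)))) (at w)"
    by (rule DERIV_cong[OF DERIV_add[OF DERIV_const DERIV_sum[OF DERIV_add[OF
          DERIV_cmult[OF lcos_has_derivative[OF assms]]
          DERIV_cmult[OF lsin_has_derivative[OF assms]]]]]]) simp
  moreover have "(\<Sum>k=1..N. of_real (a k) * (- of_nat k * lsin k w / (\<i> * w)) +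
         of_real (b k) * (of_nat k * lcos k w / (\<i> * w))) = ltrig N (dcos b) (dsin a) w / (\<i> * w)"
    unfolding ltrig_def
    by (simp only: sum_divide_distrib add_divide_distrib of_real_mult of_nat_0 mult_zero_left
          of_real_0 div_0 add_0_left)
       (auto intro!: sum.cong simp: divide_inverse algebra_simps)
  ultimately show ?thesis
    unfolding ltrig_def[abs_def] by simp
qed

lemma laurent_ends_powers:
  assumes "0 < k"
  shows "laurent_ends k c d (\<lambda>w. c * w ^ k + d * inverse w ^ k)"
proof -
  let ?H = "monom c (2 * k) + [:d:]"
  have "degree ?H \<le> 2 * k"
    by (intro degree_add_le degree_monom_le) simp
  moreover have "coeff ?H (2 * k) = c" "coeff ?H 0 = d"
    using assms by (simp_all add: coeff_pCons split: nat.split)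
  moreover have "w ^ k * (c * w ^ k + d * inverse w ^ k) = poly ?H w" if "w \<noteq> 0" for w
  proof -
    have "w ^ k * inverse w ^ k = 1"
      using that by (simp add: power_mult_distrib[symmetric])
    then show ?thesis
      by (simp add: poly_monom power_add[symmetric] mult_2[symmetric] algebra_simps)
  qed
  ultimately show ?thesis
    unfolding laurent_ends_def by blast
qed

lemma laurent_ends_lcos:
  assumes "0 < k"
  shows "laurent_ends k (1 / 2) (1 / 2) (lcos k)"
proof -
  have "lcos k = (\<lambda>w. 1 / 2 * w ^ k + 1 / 2 * inverse w ^ k)"
    by (rule ext) (simp only: lcos_def add_divide_distrib times_divide_eq_left mult_1_left)
  then show ?thesis
    using laurent_ends_powers[OF assms, of "1 / 2" "1 / 2"] by (simp only:)
qed

lemma laurent_ends_lsin: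
  assumes "0 < k"
  shows "laurent_ends k (1 / (2 * \<i>)) (- (1 / (2 * \<i>))) (lsin k)"
proof -
  have "lsin k = (\<lambda>w. 1 / (2 * \<i>) * w ^ k + - (1 / (2 * \<i>)) * inverse w ^ k)"
    by (rule ext) (simp only: lsin_def diff_divide_distrib times_divide_eq_left mult_1_left
        mult_minus_left minus_divide_left[symmetric] add_uminus_conv_diff)
  then show ?thesis
    using laurent_ends_powers[OF assms, of "1 / (2 * \<i>)" "- (1 / (2 * \<i>))"] by (simp only:)
qed

lemma ltrig_Suc:
  "ltrig (Suc N) a b w = ltrig N a b w +
     (of_real (a (Suc N)) * lcos (Suc N) w + of_real (b (Suc N)) * lsin (Suc N) w)"
  by (simp add: ltrig_def)

lemma laurent_ltrig: "laurent N (ltrig N a b)"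
proof (induction N)
  case 0
  then show ?case by (simp add: ltrig_def[abs_def] laurent_const)
next
  case (Suc N)
  show ?case
    unfolding ltrig_Suc[abs_def]
    by (rule laurent_add[OF laurent_mono[OF Suc] laurent_add[OF
          laurent_cmult[OF laurent_ends_imp_laurent[OF laurent_ends_lcos]]
          laurent_cmult[OF laurent_ends_imp_laurent[OF laurent_ends_lsin]]]]) simp_all
qed

text \<open>Only the top harmonic reaches the exponents \<open>N\<close> and \<open>- N\<close>; the
  lower ones enter with end coefficients 0.\<close>

lemma laurent_ends_ltrig:
  assumes "0 < N"
  shows "laurent_ends N (Complex (a N) (- b N) / 2) (Complex (a N) (b N) / 2) (ltrig N a b)"
proof -
  obtain n where N: "N = Suc n" using assms by (cases N) auto
  have "laurent_ends N (0 + (of_real (a N) * (1 / 2) + of_real (b N) * (1 / (2 * \<i>))))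
      (0 + (of_real (a N) * (1 / 2) + of_real (b N) * - (1 / (2 * \<i>)))) (ltrig N a b)"
    unfolding N ltrig_Suc[abs_def]
    by (rule laurent_ends_add[OF laurent_ends_Suc[OF laurent_ltrig] laurent_ends_add[OF
          laurent_ends_cmult[OF laurent_ends_lcos] laurent_ends_cmult[OF laurent_ends_lsin]]]) simp_all
  moreover have "0 + (of_real (a N) * (1 / 2) + of_real (b N) * (1 / (2 * \<i>))) = Complex (a N) (- b N) / 2"
    "0 + (of_real (a N) * (1 / 2) + of_real (b N) * - (1 / (2 * \<i>))) = Complex (a N) (b N) / 2"
    by (simp_all add: complex_eq_iff Re_divide Im_divide power2_eq_square)
  ultimately show ?thesis by (simp only:)
qed

text \<open>The end coefficients determine the top pair of coefficients, so the harmonics can be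
  stripped off from the top.\<close>

lemma ltrig_eq_0_imp_coeffs_eq_0:
  assumes "\<And>w. w \<noteq> 0 \<Longrightarrow> ltrig N a b w = 0"
  shows "k \<le> N \<Longrightarrow> a k = 0 \<and> (1 \<le> k \<longrightarrow> b k = 0)"
  using assms
proof (induction N)
  case 0
  from "0.prems"(2)[of 1] "0.prems"(1) show ?case by (simp add: ltrig_def)
next
  case (Suc N)
  have "Complex (a (Suc N)) (- b (Suc N)) / 2 = 0"
    using laurent_ends_eq_0(1)[OF laurent_ends_ltrig[of "Suc N" a b]] Suc.prems(2) by blast
  then have ab: "a (Suc N) = 0" "b (Suc N) = 0"
    by (auto simp: complex_eq_iff)
  then have "ltrig N a b w = 0" if "w \<noteq> 0" for w
    using Suc.prems(2)[OF that] by (simp add: ltrig_Suc)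
  then show ?case using Suc ab by (auto simp: le_Suc_eq)
qed

definition lX :: "nat \<Rightarrow> (nat \<Rightarrow> real) \<Rightarrow> (nat \<Rightarrow> real) \<Rightarrow> complex \<Rightarrow> complex" where
  "lX N a b w = ltrig N a b w * lcos 1 w - ltrig N (dcos b) (dsin a) w * lsin 1 w"

definition lY :: "nat \<Rightarrow> (nat \<Rightarrow> real) \<Rightarrow> (nat \<Rightarrow> real) \<Rightarrow> complex \<Rightarrow> complex" where
  "lY N a b w = ltrig N a b w * lsin 1 w + ltrig N (dcos b) (dsin a) w * lcos 1 w"

definition curve_point :: "nat \<Rightarrow> (nat \<Rightarrow> real) \<Rightarrow> (nat \<Rightarrow> real) \<Rightarrow> real \<Rightarrow> real \<times> real" where
  "curve_point N a b \<theta> = (let p = trig_poly N a b; p' = trig_poly N (dcos b) (dsin a) in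
      (p \<theta> * cos \<theta> - p' \<theta> * sin \<theta>, p \<theta> * sin \<theta> + p' \<theta> * cos \<theta>))"

lemma curve_eq: "curve N a b = curve_point N a b ` {-pi..pi}"
  by (simp add: curve_def curve_point_def[abs_def] deriv_trig_poly Let_def)

lemma lX_cis: "lX N a b (cis \<theta>) = of_real (fst (curve_point N a b \<theta>))"
  and lY_cis: "lY N a b (cis \<theta>) = of_real (snd (curve_point N a b \<theta>))"
  using lcos_cis[of 1 \<theta>] lsin_cis[of 1 \<theta>]
  by (simp_all add: lX_def lY_def curve_point_def ltrig_cis Let_def)

lemma peval_cis:
  "peval g (lX N a b (cis \<theta>)) (lY N a b (cis \<theta>)) =
     of_real (case curve_point N a b \<theta> of (x, y) \<Rightarrow> eval2 g x y)"
  by (simp add: lX_cis lY_cis of_real_peval[symmetric] eval2_eq_peval split: prod.split)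

text \<open>At both ends the term with \<open>p'\<close> contributes \<open>- N\<close> times what
  the term with \<open>p\<close> contributes, whence the factor \<open>1 - N\<close>, which is
  nonzero for \<open>N \<ge> 2\<close>.\<close>

lemma laurent_ends_lX:
  assumes "0 < N"
  shows "laurent_ends (Suc N) ((1 - of_nat N) * Complex (a N) (- b N) / 4)
    ((1 - of_nat N) * Complex (a N) (b N) / 4) (lX N a b)"
proof -
  have *: "laurent_ends (N + 1)
      (Complex (a N) (- b N) / 2 * (1 / 2) - Complex (dcos b N) (- dsin a N) / 2 * (1 / (2 * \<i>)))
      (Complex (a N) (b N) / 2 * (1 / 2) - Complex (dcos b N) (dsin a N) / 2 * - (1 / (2 * \<i>)))
      (lX N a b)"
    unfolding lX_def[abs_def]
    by (rule laurent_ends_diff[OF laurent_ends_mult[OF laurent_ends_ltrig laurent_ends_lcos]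
          laurent_ends_mult[OF laurent_ends_ltrig laurent_ends_lsin]]) (use assms in simp_all)
  have eqs: "Complex (a N) (- b N) / 2 * (1 / 2) - Complex (dcos b N) (- dsin a N) / 2 * (1 / (2 * \<i>))
      = (1 - of_nat N) * Complex (a N) (- b N) / 4"
    "Complex (a N) (b N) / 2 * (1 / 2) - Complex (dcos b N) (dsin a N) / 2 * - (1 / (2 * \<i>))
      = (1 - of_nat N) * Complex (a N) (b N) / 4"
    by (simp_all add: complex_eq_iff Re_divide Im_divide power2_eq_square field_simps)
  show ?thesis using * unfolding eqs by simp
qed

lemma laurent_lX: "laurent (Suc N) (lX N a b)"
  and laurent_lY: "laurent (Suc N) (lY N a b)"
proof -
  have "laurent 1 (lcos 1)" "laurent 1 (lsin 1)"
    by (auto intro: laurent_ends_imp_laurent laurent_ends_lcos laurent_ends_lsin)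
  note * = laurent_mult[OF laurent_ltrig this(1)] laurent_mult[OF laurent_ltrig this(2)]
  show "laurent (Suc N) (lX N a b)"
    unfolding lX_def[abs_def] Suc_eq_plus1 by (rule laurent_diff[OF *])
  show "laurent (Suc N) (lY N a b)"
    unfolding lY_def[abs_def] Suc_eq_plus1 by (rule laurent_add[OF *(2,1)])
qed

text \<open>This is \<open>p + p''\<close>: the velocity of the parametrization is \<open>(p + p'') (- sin \<theta>, cos \<theta>)\<close>.\<close>

definition lspeed :: "nat \<Rightarrow> (nat \<Rightarrow> real) \<Rightarrow> (nat \<Rightarrow> real) \<Rightarrow> complex \<Rightarrow> complex" where
  "lspeed N a b = ltrig N (\<lambda>k. (1 - real k ^ 2) * a k) (\<lambda>k. (1 - real k ^ 2) * b k)"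

lemma lspeed_eq: "lspeed N a b w = ltrig N a b w + ltrig N (dcos (dsin a)) (dsin (dcos b)) w"
proof -
  have "of_real ((1 - real k ^ 2) * a k) * lcos k w + of_real ((1 - real k ^ 2) * b k) * lsin k w =
      (of_real (a k) * lcos k w + of_real (b k) * lsin k w) +
      (of_real (dcos (dsin a) k) * lcos k w + of_real (dsin (dcos b) k) * lsin k w)" for k
    by (simp add: power2_eq_square algebra_simps)
  then show ?thesis
    unfolding lspeed_def ltrig_def by (simp only: sum.distrib) simp
qed

text \<open>The terms with \<open>p'\<close> cancel, which leaves \<open>p + p''\<close> times
  \<open>- sin \<theta>\<close>, again with the factor \<open>d\<theta> / dw\<close>.\<close>

lemma lX_has_derivative:
  assumes "w \<noteq> 0"
  shows "(lX N a b has_field_derivative - lspeed N a b w * lsin 1 w / (\<i> * w)) (at w)"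
proof -
  have *: "p1 / u * c + - of_nat 1 * s / u * p - (p2 / u * s + of_nat 1 * c / u * p1) = - (p + p2) * s / u"
    for p p1 p2 c s u :: complex
    by (simp add: add_divide_distrib diff_divide_distrib algebra_simps)
  show ?thesis
    unfolding lX_def[abs_def] lspeed_eq
    by (rule DERIV_cong[OF DERIV_diff[OF
          DERIV_mult[OF ltrig_has_derivative[OF assms] lcos_has_derivative[OF assms]]
          DERIV_mult[OF ltrig_has_derivative[OF assms] lsin_has_derivative[OF assms]]] *])
qed

lemma lY_has_derivative:
  assumes "w \<noteq> 0"
  shows "(lY N a b has_field_derivative lspeed N a b w * lcos 1 w / (\<i> * w)) (at w)"
proof -
  have *: "p1 / u * s + of_nat 1 * c / u * p + (p2 / u * c + - of_nat 1 * s / u * p1) = (p + p2) * c / u"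
    for p p1 p2 c s u :: complex
    by (simp add: add_divide_distrib diff_divide_distrib algebra_simps)
  show ?thesis
    unfolding lY_def[abs_def] lspeed_eq
    by (rule DERIV_cong[OF DERIV_add[OF
          DERIV_mult[OF ltrig_has_derivative[OF assms] lsin_has_derivative[OF assms]]
          DERIV_mult[OF ltrig_has_derivative[OF assms] lcos_has_derivative[OF assms]]] *])
qed

lemma lcos_minus: "lcos k (- w) = (-1) ^ k * lcos k w"
  unfolding lcos_def inverse_minus_eq power_minus[of w] power_minus[of "inverse w"]
  by (simp only: distrib_left times_divide_eq_right)

lemma lsin_minus: "lsin k (- w) = (-1) ^ k * lsin k w"
  unfolding lsin_def inverse_minus_eq power_minus[of w] power_minus[of "inverse w"]
  by (simp only: right_diff_distrib times_divide_eq_right)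

lemma ltrig_minus_odd:
  assumes "\<forall>k. 2 * k \<le> N \<longrightarrow> a (2 * k) = 0 \<and> (1 \<le> k \<longrightarrow> b (2 * k) = 0)"
  shows "ltrig N a b (- w) = - ltrig N a b w"
proof -
  have "of_real (a k) * lcos k (- w) + of_real (b k) * lsin k (- w) =
      - (of_real (a k) * lcos k w + of_real (b k) * lsin k w)" if "k \<in> {1..N}" for k
  proof (cases "even k")
    case True
    then obtain l where "k = 2 * l" by blast
    with that assms have "a k = 0" "b k = 0" by auto
    then show ?thesis by simp
  next
    case False
    then show ?thesis by (simp add: lcos_minus lsin_minus)
  qed
  moreover have "a 0 = 0" using assms[rule_format, of 0] by simp
  ultimately show ?thesis
    unfolding ltrig_def by (simp add: sum_negf[symmetric])
qed

text \<open>Passing from \<open>w\<close> to \<open>- w\<close> shifts \<open>\<theta>\<close> by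
  \<open>pi\<close>. With odd harmonics only, \<open>p\<close> and \<open>p'\<close> change sign,
  and so do \<open>cos \<theta>\<close> and \<open>sin \<theta>\<close>.\<close>

lemma lXY_even:
  assumes "\<forall>k. 2 * k \<le> N \<longrightarrow> a (2 * k) = 0 \<and> (1 \<le> k \<longrightarrow> b (2 * k) = 0)"
  shows "lX N a b (- w) = lX N a b w" "lY N a b (- w) = lY N a b w"
proof -
  have "\<forall>k. 2 * k \<le> N \<longrightarrow> dcos b (2 * k) = 0 \<and> (1 \<le> k \<longrightarrow> dsin a (2 * k) = 0)"
    using assms by auto
  note odd = ltrig_minus_odd[OF assms, of w] ltrig_minus_odd[OF this, of w]
  show "lX N a b (- w) = lX N a b w" "lY N a b (- w) = lY N a b w"
    unfolding lX_def lY_def odd lcos_minus lsin_minus by simp_all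
qed

lemma lcos_sin_squares: "w \<noteq> 0 \<Longrightarrow> lcos 1 w ^ 2 + lsin 1 w ^ 2 = 1"
proof -
  assume "w \<noteq> 0"
  then have "w * inverse w = 1" by simp
  moreover have "((w + v) / 2) ^ 2 + ((w - v) / (2 * \<i>)) ^ 2 = w * v" for v
    by (simp add: power2_eq_square field_simps)
  ultimately show ?thesis by (simp only: lcos_def lsin_def power_one_right)
qed

text \<open>Since \<open>p = X cos \<theta> + Y sin \<theta>\<close>, even \<open>X\<close> and
  \<open>Y\<close> make \<open>p\<close> change sign under \<open>w\<close> to \<open>- w\<close>,
  so the even harmonics of \<open>p\<close> sum to 0.\<close>

lemma lXY_even_imp_coeffs:
  assumes "\<And>w. w \<noteq> 0 \<Longrightarrow> lX N a b (- w) = lX N a b w" "\<And>w. w \<noteq> 0 \<Longrightarrow> lY N a b (- w) = lY N a b w"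
  shows "\<forall>k. 2 * k \<le> N \<longrightarrow> a (2 * k) = 0 \<and> (1 \<le> k \<longrightarrow> b (2 * k) = 0)"
proof -
  have p: "ltrig N a b w = lX N a b w * lcos 1 w + lY N a b w * lsin 1 w" if "w \<noteq> 0" for w
  proof -
    have "lX N a b w * lcos 1 w + lY N a b w * lsin 1 w = ltrig N a b w * (lcos 1 w ^ 2 + lsin 1 w ^ 2)"
      by (simp add: lX_def lY_def power2_eq_square algebra_simps)
    then show ?thesis using lcos_sin_squares[OF that] by simp
  qed
  let ?a = "\<lambda>k. if even k then a k else 0" and ?b = "\<lambda>k. if even k then b k else 0"
  have "ltrig N ?a ?b w = 0" if "w \<noteq> 0" for w
  proof -
    have "2 * ltrig N ?a ?b w = ltrig N a b w + ltrig N a b (- w)"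
      unfolding ltrig_def lcos_minus lsin_minus
      by (simp add: sum.distrib[symmetric] distrib_left sum_distrib_left)
         (intro sum.cong; auto)
    also have "\<dots> = 0"
      using p[OF that] p[of "- w"] that assms by (simp add: lcos_minus lsin_minus)
    finally show ?thesis by simp
  qed
  from ltrig_eq_0_imp_coeffs_eq_0[OF this] show ?thesis by fastforce
qed

section \<open>Upper bound for the degree\<close>

lemma inj_on_cis: "inj_on cis {0<..<pi}"
  by (rule inj_onI) (metis cis.simps(1) cos_inj_pi greaterThanLessThan_iff less_imp_le)

lemma infinite_open_interval: "infinite {0<..<pi}"
  using infinite_Ioo[OF pi_gt_zero] .

lemma infinite_cis: "infinite (cis ` {0<..<pi})"
  using inj_on_cis infinite_open_interval finite_image_iff by blast

text \<open>Identity principle: the curve supplies infinitely many zeros on the unit circle, so a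
  real equation on the curve becomes an identity for all nonzero complex \<open>w\<close>.\<close>

lemma curve_vanishing_iff:
  "(\<forall>(x, y)\<in>curve N a b. eval2 g x y = 0) \<longleftrightarrow> (\<forall>w. w \<noteq> 0 \<longrightarrow> peval g (lX N a b w) (lY N a b w) = 0)"
proof
  assume van: "\<forall>(x, y)\<in>curve N a b. eval2 g x y = 0"
  have zero: "peval g (lX N a b (cis \<theta>)) (lY N a b (cis \<theta>)) = 0" if "\<theta> \<in> {0<..<pi}" for \<theta>
  proof -
    have "curve_point N a b \<theta> \<in> curve N a b"
      unfolding curve_eq using that by (intro imageI) auto
    with van show ?thesis by (auto simp: peval_cis split: prod.splits)
  qed
  have sub: "cis ` {0<..<pi} \<subseteq> {w. w \<noteq> 0 \<and> peval g (lX N a b w) (lY N a b w) = 0}"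
    using zero by auto
  have inf: "infinite {w. w \<noteq> 0 \<and> peval g (lX N a b w) (lY N a b w) = 0}"
    using infinite_super[OF sub infinite_cis] .
  show "\<forall>w. w \<noteq> 0 \<longrightarrow> peval g (lX N a b w) (lY N a b w) = 0"
    using laurent_eq_0I_infinite[OF laurent_peval[OF laurent_lX laurent_lY order_refl] inf] by blast
next
  assume "\<forall>w. w \<noteq> 0 \<longrightarrow> peval g (lX N a b w) (lY N a b w) = 0"
  then have zero: "peval g (lX N a b (cis \<theta>)) (lY N a b (cis \<theta>)) = 0" for \<theta> by simp
  show "\<forall>(x, y)\<in>curve N a b. eval2 g x y = 0"
  proof clarify
    fix x y assume "(x, y) \<in> curve N a b"
    then obtain \<theta> where \<theta>: "(x, y) = curve_point N a b \<theta>"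
      unfolding curve_eq by blast
    show "eval2 g x y = 0"
      using zero[of \<theta>] by (simp add: peval_cis \<theta>[symmetric])
  qed
qed

lemma Complex_end_neq_0:
  assumes "N \<ge> 2" "a N \<noteq> 0 \<or> b N \<noteq> 0"
  shows "(1 - of_nat N) * Complex (a N) (- b N) / 4 \<noteq> 0" "(1 - of_nat N) * Complex (a N) (b N) / 4 \<noteq> 0"
proof -
  have "(1 - of_nat N :: complex) \<noteq> 0"
    using assms(1) by (metis Suc_1 Suc_n_not_le_n of_nat_1 of_nat_eq_iff right_minus_eq One_nat_def)
  then show "(1 - of_nat N) * Complex (a N) (- b N) / 4 \<noteq> 0" "(1 - of_nat N) * Complex (a N) (b N) / 4 \<noteq> 0"
    using assms(2) by (auto simp: complex_eq_iff)
qed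

text \<open>Otherwise some value \<open>c\<close> is taken infinitely often, although
  \<open>X - c\<close> has a nonzero end coefficient and so only finitely many zeros.\<close>

lemma infinite_fst_curve:
  assumes "N \<ge> 2" "a N \<noteq> 0 \<or> b N \<noteq> 0"
  shows "infinite (fst ` curve N a b)"
proof
  let ?x = "\<lambda>\<theta>. fst (curve_point N a b \<theta>)"
  assume "finite (fst ` curve N a b)"
  then have "finite (?x ` {-pi..pi})" by (simp add: curve_eq image_image)
  then have "finite (?x ` {0<..<pi})"
    by (rule finite_subset[rotated]) auto
  then obtain c where "infinite (?x -` {c} \<inter> {0<..<pi})"
    using inf_img_fin_domE'[OF _ infinite_open_interval] by blast
  then have inf: "infinite (cis ` (?x -` {c} \<inter> {0<..<pi}))"
    using finite_image_iff inj_on_cis inj_on_subset by (metis inf_le2)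
  have "laurent_ends (Suc N) ((1 - of_nat N) * Complex (a N) (- b N) / 4 - 0)
      ((1 - of_nat N) * Complex (a N) (b N) / 4 - 0) (\<lambda>w. lX N a b w - of_real c)"
    using assms by (intro laurent_ends_diff laurent_ends_lX laurent_ends_Suc laurent_const) auto
  then have "finite {w. w \<noteq> 0 \<and> lX N a b w - of_real c = 0}"
    by (rule laurent_ends_finite_zeros) (use Complex_end_neq_0(1)[of N a b] assms in simp)
  moreover have "cis ` (?x -` {c} \<inter> {0<..<pi}) \<subseteq> {w. w \<noteq> 0 \<and> lX N a b w - of_real c = 0}"
    by (auto simp: lX_cis)
  ultimately show False using inf finite_subset by blast
qed

text \<open>\<open>g\<close> is sampled at the parameters \<open>T\<close>, but zeros are counted on
  \<open>V\<close>, where every \<open>w\<close> has the same image as some \<open>\<theta>\<close>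
  in \<open>T\<close>. \<open>V\<close> may be larger than \<open>T\<close>, which is what halves
  the sample in the even case.\<close>

lemma curve_sampling:
  assumes T: "T \<subseteq> {0<..<pi}" "finite T" and V: "finite V" "2 * (m * Suc N) < card V"
    and VT: "\<And>w. w \<in> V \<Longrightarrow> \<exists>\<theta>\<in>T. lX N a b w = lX N a b (cis \<theta>) \<and> lY N a b w = lY N a b (cis \<theta>) \<and> w \<noteq> 0"
    and g: "total_degree g \<le> m" "\<forall>(x, y)\<in>curve_point N a b ` T. eval2 g x y = 0"
  shows "\<forall>(x, y)\<in>curve N a b. eval2 g x y = 0"
  unfolding curve_vanishing_iff
proof (intro allI impI)
  fix w :: complex assume "w \<noteq> 0"
  show "peval g (lX N a b w) (lY N a b w) = 0"
  proof (rule laurent_eq_0I[OF laurent_peval[OF laurent_lX laurent_lY g(1)] V _ \<open>w \<noteq> 0\<close>])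
    fix v assume "v \<in> V"
    then obtain \<theta> where \<theta>: "\<theta> \<in> T" "lX N a b v = lX N a b (cis \<theta>)" "lY N a b v = lY N a b (cis \<theta>)" "v \<noteq> 0"
      using VT by blast
    have "(case curve_point N a b \<theta> of (x, y) \<Rightarrow> eval2 g x y = 0)"
      using g(2) \<theta>(1) by auto
    then have "peval g (lX N a b v) (lY N a b v) = 0"
      unfolding \<theta>(2,3) peval_cis by (auto split: prod.splits)
    with \<theta>(4) show "v \<noteq> 0 \<and> peval g (lX N a b v) (lY N a b v) = 0" by blast
  qed
qed

lemma total_degree_le_general:
  assumes "N \<ge> 2" "a N \<noteq> 0 \<or> b N \<noteq> 0" "irreducible f" "\<forall>(x, y)\<in>curve N a b. eval2 f x y = 0"
  shows "total_degree f \<le> 2 * N + 2"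
proof (rule total_degree_le_if_sampling[OF assms(3,4) infinite_fst_curve[of N a b, OF assms(1,2)]])
  fix m
  \<comment> \<open>One more than the number of zeros that a nonzero restriction of degree at most
    \<open>m\<close> can have.\<close>
  obtain T where T: "T \<subseteq> {0<..<pi}" "finite T" "card T = 2 * (m * Suc N) + 1"
    using infinite_arbitrarily_large[OF infinite_open_interval] by blast
  have "card (cis ` T) = card T"
    using T inj_on_cis by (intro card_image) (auto intro: inj_on_subset)
  then have "2 * (m * Suc N) < card (cis ` T)" using T(3) by simp
  then have samp: "\<forall>(x, y)\<in>curve N a b. eval2 g x y = 0"
    if "total_degree g \<le> m" "\<forall>(x, y)\<in>curve_point N a b ` T. eval2 g x y = 0" for g
    by (rule curve_sampling[OF T(1,2) finite_imageI[OF T(2)] _ _ that]) auto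
  have "card (curve_point N a b ` T) \<le> (2 * N + 2) * m + 1"
    using card_image_le[OF T(2), of "curve_point N a b"] T(3) by (simp add: algebra_simps)
  with samp T(2) show "\<exists>W. finite W \<and> card W \<le> (2 * N + 2) * m + 1 \<and>
      (\<forall>g. total_degree g \<le> m \<longrightarrow> (\<forall>(x, y)\<in>W. eval2 g x y = 0) \<longrightarrow>
         (\<forall>(x, y)\<in>curve N a b. eval2 g x y = 0))"
    by (intro exI[of _ "curve_point N a b ` T"]) blast
qed

lemma total_degree_le_even:
  assumes "N \<ge> 2" "a N \<noteq> 0 \<or> b N \<noteq> 0" "irreducible f" "\<forall>(x, y)\<in>curve N a b. eval2 f x y = 0"
    and even: "\<forall>k. 2 * k \<le> N \<longrightarrow> a (2 * k) = 0 \<and> (1 \<le> k \<longrightarrow> b (2 * k) = 0)"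
  shows "total_degree f \<le> N + 1"
proof (rule total_degree_le_if_sampling[OF assms(3,4) infinite_fst_curve[of N a b, OF assms(1,2)]])
  fix m
  obtain T where T: "T \<subseteq> {0<..<pi}" "finite T" "card T = m * Suc N + 1"
    using infinite_arbitrarily_large[OF infinite_open_interval] by blast
  \<comment> \<open>Each sample point now accounts for two zeros, \<open>w\<close> and
    \<open>- w\<close>. They are distinct because \<open>T\<close> lies in \<open>{0<..<pi}\<close>,
    which puts them in opposite half planes.\<close>
  let ?V = "cis ` T \<union> uminus ` cis ` T"
  have "inj_on cis T" using T(1) inj_on_cis inj_on_subset by blast
  then have c: "card (cis ` T) = card T" "card (uminus ` cis ` T) = card T"
    by (auto simp: card_image)
  have "\<forall>w\<in>cis ` T. 0 < Im w" "\<forall>w\<in>uminus ` cis ` T. Im w < 0"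
    using T(1) by (auto intro!: sin_gt_zero)
  then have "cis ` T \<inter> uminus ` cis ` T = {}"
    by (meson disjoint_iff less_asym)
  then have "card ?V = card T + card T"
    using card_Un_disjoint[of "cis ` T" "uminus ` cis ` T"] T(2) c by simp
  then have "2 * (m * Suc N) < card ?V" using T(3) by simp
  moreover have "finite ?V" using T(2) by simp
  moreover have "\<exists>\<theta>\<in>T. lX N a b w = lX N a b (cis \<theta>) \<and> lY N a b w = lY N a b (cis \<theta>) \<and> w \<noteq> 0"
    if "w \<in> ?V" for w
    using that lXY_even[OF even] by auto
  ultimately have samp: "\<forall>(x, y)\<in>curve N a b. eval2 g x y = 0"
    if "total_degree g \<le> m" "\<forall>(x, y)\<in>curve_point N a b ` T. eval2 g x y = 0" for g
    using curve_sampling[OF T(1,2) _ _ _ that, of ?V] by blast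
  have "card (curve_point N a b ` T) \<le> (N + 1) * m + 1"
    using card_image_le[OF T(2), of "curve_point N a b"] T(3) by (simp add: algebra_simps)
  with samp T(2) show "\<exists>W. finite W \<and> card W \<le> (N + 1) * m + 1 \<and>
      (\<forall>g. total_degree g \<le> m \<longrightarrow> (\<forall>(x, y)\<in>W. eval2 g x y = 0) \<longrightarrow>
         (\<forall>(x, y)\<in>curve N a b. eval2 g x y = 0))"
    by (intro exI[of _ "curve_point N a b ` T"]) blast
qed

section \<open>Lower bound for the degree\<close>

text \<open>Over the complex numbers the degree counts roots with multiplicity, and here each
  multiplicity is 1.\<close>

lemma card_roots_rsquarefree:
  fixes p :: "complex poly"
  assumes "rsquarefree p"
  shows "card {z. poly p z = 0} = degree p"
proof -
  have nz: "p \<noteq> 0" and ord: "\<And>a. order a p = 0 \<or> order a p = 1"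
    using assms by (auto simp: rsquarefree_def)
  have "degree p = (\<Sum>z\<in>set_mset (proots p). count (proots p) z)"
    by (simp add: size_proots_complex[symmetric] size_multiset_overloaded_eq)
  also have "\<dots> = (\<Sum>z\<in>{z. poly p z = 0}. 1)"
    using nz ord by (intro sum.cong) (auto simp: order_root, metis One_nat_def less_irrefl)
  finally show ?thesis by simp
qed

text \<open>\<open>w ^ K * (h w - \<gamma>)\<close> is a polynomial of degree \<open>2 * K\<close>
  that is nonzero at 0, and the nonzero derivative of \<open>h\<close> on the fibre makes its roots
  simple.\<close>

lemma card_laurent_fibre:
  assumes h: "laurent_ends K \<alpha> \<beta> h" and nz: "\<alpha> \<noteq> 0" "\<beta> \<noteq> 0" and K: "0 < K"
    and simple: "\<And>w. w \<noteq> 0 \<Longrightarrow> h w = \<gamma> \<Longrightarrow> \<exists>D. D \<noteq> 0 \<and> (h has_field_derivative D) (at w)"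
  shows "card {w. w \<noteq> 0 \<and> h w = \<gamma>} = 2 * K"
proof -
  obtain H where H: "degree H \<le> 2 * K" "coeff H (2 * K) = \<alpha>" "coeff H 0 = \<beta>"
      "\<And>w. w \<noteq> 0 \<Longrightarrow> w ^ K * h w = poly H w"
    using h by (auto simp: laurent_ends_def)
  \<comment> \<open>\<open>0 < K\<close> keeps the middle term \<open>\<gamma> * w ^ K\<close> away
    from both end coefficients.\<close>
  define P where "P = H - monom \<gamma> K"
  have deg: "degree P = 2 * K"
  proof (rule antisym)
    have "degree (monom \<gamma> K) \<le> 2 * K"
      using degree_monom_le[of \<gamma> K] by simp
    then show "degree P \<le> 2 * K"
      unfolding P_def using H(1) by (intro degree_diff_le) auto
    show "2 * K \<le> degree P"
      using H(2) nz K by (intro le_degree) (simp add: P_def)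
  qed
  have P: "poly P w = w ^ K * (h w - \<gamma>)" if "w \<noteq> 0" for w
    using H(4)[OF that] by (simp add: P_def poly_monom algebra_simps)
  have P0: "poly P 0 \<noteq> 0"
    using H(3) nz K by (simp add: P_def poly_0_coeff_0)
  have "rsquarefree P"
    unfolding rsquarefree_roots
  proof (intro allI notI, elim conjE)
    fix w assume w: "poly P w = 0" "poly (pderiv P) w = 0"
    then have "w \<noteq> 0" using P0 by auto
    then have "h w = \<gamma>" using P w(1) by simp
    then obtain D where D: "D \<noteq> 0" "(h has_field_derivative D) (at w)"
      using simple \<open>w \<noteq> 0\<close> by blast
    have "((\<lambda>w. w ^ K * (h w - \<gamma>)) has_field_derivative
        (of_nat K * w ^ K / w) * (h w - \<gamma>) + (D - 0) * w ^ K) (at w)"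
      by (rule DERIV_mult[OF power_has_derivative[OF \<open>w \<noteq> 0\<close>] DERIV_diff[OF D(2) DERIV_const]])
    then have "((\<lambda>w. w ^ K * (h w - \<gamma>)) has_field_derivative D * w ^ K) (at w)"
      by (simp add: \<open>h w = \<gamma>\<close>)
    then have "(poly P has_field_derivative D * w ^ K) (at w)"
      by (rule has_field_derivative_transform_within_open[where S="- {0}"])
         (use \<open>w \<noteq> 0\<close> P in auto)
    with poly_DERIV[of P w] w(2) have "D * w ^ K = 0"
      using DERIV_unique by fastforce
    with D(1) \<open>w \<noteq> 0\<close> show False by simp
  qed
  then have "card {w. poly P w = 0} = 2 * K"
    using card_roots_rsquarefree deg by simp
  moreover have "{w. poly P w = 0} = {w. w \<noteq> 0 \<and> h w = \<gamma>}"
  proof (rule set_eqI)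
    fix w show "w \<in> {w. poly P w = 0} \<longleftrightarrow> w \<in> {w. w \<noteq> 0 \<and> h w = \<gamma>}"
      using P[of w] P0 by (cases "w = 0") auto
  qed
  ultimately show ?thesis by simp
qed

text \<open>A point of the curve with nonvanishing gradient determines its tangent direction, hence \<open>w\<^sup>2\<close>.\<close>

lemma same_point_imp_square_eq:
  assumes van: "\<And>w. w \<noteq> 0 \<Longrightarrow> peval f (lX N a b w) (lY N a b w) = 0"
    and nz: "w \<noteq> 0" "v \<noteq> 0"
    and eq: "lX N a b w = lX N a b v" "lY N a b w = lY N a b v"
    and speed: "lspeed N a b w \<noteq> 0" "lspeed N a b v \<noteq> 0"
    and B: "peval (pderiv f) (lX N a b w) (lY N a b w) \<noteq> 0"
  shows "w = v \<or> w = - v"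
proof -
  let ?A = "peval (map_poly pderiv f) (lX N a b w) (lY N a b w)"
  let ?B = "peval (pderiv f) (lX N a b w) (lY N a b w)"
  \<comment> \<open>Differentiating \<open>f (X, Y) = 0\<close> and dividing by the speed leaves
    \<open>?A * sin = ?B * cos\<close>. In terms of \<open>z\<close> this is a linear equation for
    \<open>z ^ 2\<close>, the same for all parameters of the point.\<close>
  have tangent: "(?A - \<i> * ?B) * z ^ 2 = ?A + \<i> * ?B"
    if z: "z \<noteq> 0" "lX N a b z = lX N a b w" "lY N a b z = lY N a b w" "lspeed N a b z \<noteq> 0" for z
  proof -
    let ?q = "lspeed N a b z"
    have "((\<lambda>w. peval f (lX N a b w) (lY N a b w)) has_field_derivative
        ?A * (- ?q * lsin 1 z / (\<i> * z)) + ?B * (?q * lcos 1 z / (\<i> * z))) (at z)"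
      using has_field_derivative_peval[OF lX_has_derivative[OF z(1), of N a b]
          lY_has_derivative[OF z(1), of N a b], of f]
      by (simp only: z(2,3))
    moreover have "((\<lambda>w. peval f (lX N a b w) (lY N a b w)) has_field_derivative 0) (at z)"
      by (rule has_field_derivative_transform_within_open[where S="- {0}" and f="\<lambda>_. 0"])
         (use z van in auto)
    ultimately have "?A * (- ?q * lsin 1 z / (\<i> * z)) + ?B * (?q * lcos 1 z / (\<i> * z)) = 0"
      by (rule DERIV_unique)
    then have "(?q / (\<i> * z)) * (?B * lcos 1 z - ?A * lsin 1 z) = 0"
      by (simp add: algebra_simps)
    then have "?A * lsin 1 z = ?B * lcos 1 z"
      using z by simp
    then have "?A * ((z - inverse z) / (2 * \<i>)) * (2 * \<i> * z) =
        ?B * ((z + inverse z) / 2) * (2 * (\<i> * z))"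
      by (simp only: lsin_def lcos_def power_one_right mult.assoc)
    moreover have cancel: "c * (u / d) * (d * v) = c * (u * v)" if "d \<noteq> 0" for c u d v :: complex
      using that by simp
    have "2 * \<i> \<noteq> 0" "(2 :: complex) \<noteq> 0" by simp_all
    note cancel[OF this(1)] cancel[OF this(2)]
    ultimately have "?A * ((z - inverse z) * z) = ?B * ((z + inverse z) * (\<i> * z))"
      by (simp only:)
    moreover have "(z - inverse z) * z = z ^ 2 - 1" "(z + inverse z) * (\<i> * z) = \<i> * (z ^ 2 + 1)"
      using z(1) by (simp_all add: power2_eq_square distrib_left distrib_right left_diff_distrib)
    ultimately have "?A * (z ^ 2 - 1) = ?B * (\<i> * (z ^ 2 + 1))" by (simp only:)
    then show ?thesis by (simp add: algebra_simps)
  qed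
  \<comment> \<open>If this coefficient were 0, then \<open>?A + \<i> * ?B\<close> would be 0 as
    well, and hence \<open>?B = 0\<close>.\<close>
  have "?A - \<i> * ?B \<noteq> 0"
  proof
    assume 0: "?A - \<i> * ?B = 0"
    then have "?A + \<i> * ?B = 0"
      using tangent[OF nz(1) refl refl speed(1)] by simp
    with 0 have "?A + \<i> * ?B - (?A - \<i> * ?B) = 0" by simp
    with B show False by simp
  qed
  then have "w ^ 2 = v ^ 2"
    using tangent[OF nz(1) refl refl speed(1)] tangent[OF nz(2) eq[symmetric] speed(2)]
    by (metis mult_left_cancel)
  then show ?thesis by (simp add: power2_eq_iff)
qed

text \<open>Otherwise \<open>f\<close> divides its \<open>y\<close>-derivative, which must then be 0
  by degree. So \<open>f\<close> depends on \<open>x\<close> only and cannot vanish at infinitely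
  many abscissae.\<close>

lemma pderiv_not_vanishing:
  assumes irr: "irreducible f" and f: "\<forall>(x, y)\<in>C. eval2 f x y = 0" and inf: "infinite (fst ` C)"
  shows "\<not> (\<forall>(x, y)\<in>C. eval2 (pderiv f) x y = 0)"
proof
  assume "\<forall>(x, y)\<in>C. eval2 (pderiv f) x y = 0"
  then have dvd: "f dvd pderiv f"
    using irreducible_dvd_if_vanishing[OF irr f inf] by blast
  have "degree f = 0"
  proof (rule ccontr)
    assume "degree f \<noteq> 0"
    then have "pderiv f \<noteq> 0" by (simp add: pderiv_eq_0_iff)
    with dvd_imp_degree_le[OF dvd] have "degree f \<le> degree (pderiv f)" by simp
    with \<open>degree f \<noteq> 0\<close> show False by (simp add: degree_pderiv)
  qed
  then obtain c where c: "f = [:c:]" by (rule degree_eq_zeroE)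
  have "fst ` C \<subseteq> {x. poly c x = 0}"
    using f by (auto simp: c eval2_def map_poly_pCons split: prod.splits)
  moreover have "c \<noteq> 0" using irr c by auto
  ultimately show False
    using inf poly_roots_finite finite_subset by blast
qed

text \<open>The curve is cut by a complex line \<open>x = \<gamma>\<close> in general position, and
  the values of \<open>Y\<close> on the fibre \<open>R\<close> are roots of
  \<open>f (\<gamma>, y)\<close>. The set \<open>E\<close> lists further parameters that the fibre
  has to avoid.\<close>

lemma generic_fibre:
  assumes N: "N \<ge> 2" and ab: "a N \<noteq> 0 \<or> b N \<noteq> 0" and irr: "irreducible f"
    and f: "\<forall>(x, y)\<in>curve N a b. eval2 f x y = 0" and E: "finite E"
  shows "\<exists>R \<gamma>. finite R \<and> card R = 2 * N + 2 \<and> card (lY N a b ` R) \<le> total_degree f \<and> R \<inter> E = {} \<and>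
    (\<forall>w\<in>R. w \<noteq> 0 \<and> lX N a b w = \<gamma>) \<and> (\<forall>w\<in>R. \<forall>v\<in>R. lY N a b w = lY N a b v \<longrightarrow> w = v \<or> w = - v)"
proof -
  let ?X = "lX N a b" and ?Y = "lY N a b"
  have N0: "0 < N" using N by simp
  have van: "peval f (?X w) (?Y w) = 0" if "w \<noteq> 0" for w
    using f that unfolding curve_vanishing_iff by blast
  \<comment> \<open>\<open>B1\<close> consists of the critical points of \<open>X\<close> and
    includes all zeros of the speed; on \<open>B2\<close> the gradient condition of
    \<open>same_point_imp_square_eq\<close> fails.\<close>
  define B1 where "B1 = {w. w \<noteq> 0 \<and> lspeed N a b w * lsin 1 w = 0}"
  define B2 where "B2 = {w. w \<noteq> 0 \<and> peval (pderiv f) (?X w) (?Y w) = 0}"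
  let ?lc = "map_poly of_real (lead_coeff f) :: complex poly"
  have "finite B1"
  proof -
    have "laurent_ends (N + 1)
        (Complex ((1 - real N ^ 2) * a N) (- ((1 - real N ^ 2) * b N)) / 2 * (1 / (2 * \<i>)))
        (Complex ((1 - real N ^ 2) * a N) ((1 - real N ^ 2) * b N) / 2 * - (1 / (2 * \<i>)))
        (\<lambda>w. lspeed N a b w * lsin 1 w)"
      unfolding lspeed_def
      by (rule laurent_ends_mult[OF laurent_ends_ltrig[OF N0] laurent_ends_lsin]) simp
    moreover have "Complex ((1 - real N ^ 2) * a N) (- ((1 - real N ^ 2) * b N)) / 2 * (1 / (2 * \<i>)) \<noteq> 0"
    proof -
      \<comment> \<open>The top harmonic of \<open>p + p''\<close> carries the factor
        \<open>1 - N ^ 2\<close>, so \<open>N \<ge> 2\<close> is essential here.\<close>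
      have "real N ^ 2 \<noteq> 1" using N by (simp add: power2_eq_1_iff)
      then show ?thesis using ab by (auto simp: complex_eq_iff)
    qed
    ultimately show ?thesis
      unfolding B1_def by (rule laurent_ends_finite_zeros)
  qed
  moreover have "finite B2"
  proof (rule ccontr)
    assume "infinite B2"
    then have "peval (pderiv f) (?X w) (?Y w) = 0" if "w \<noteq> 0" for w
      using laurent_eq_0I_infinite[OF laurent_peval[OF laurent_lX laurent_lY order_refl]] that
      unfolding B2_def by blast
    then have "\<forall>(x, y)\<in>curve N a b. eval2 (pderiv f) x y = 0"
      unfolding curve_vanishing_iff by blast
    with pderiv_not_vanishing[OF irr f infinite_fst_curve[of N a b, OF N ab]] show False by blast
  qed
  moreover have "?lc \<noteq> 0"
    using irr by (auto simp: map_poly_eq_0_iff)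
  ultimately have "finite (?X ` (B1 \<union> B2 \<union> E) \<union> {x. poly ?lc x = 0})"
    using E poly_roots_finite by blast
  \<comment> \<open>Off these finitely many values the fibre misses \<open>B1\<close>,
    \<open>B2\<close> and \<open>E\<close>, and \<open>f\<close> keeps its degree in
    \<open>y\<close> at \<open>x = \<gamma>\<close>.\<close>
  then obtain \<gamma> where \<gamma>: "\<gamma> \<notin> ?X ` (B1 \<union> B2 \<union> E)" "poly ?lc \<gamma> \<noteq> 0"
    using ex_new_if_finite[OF infinite_UNIV_char_0[where 'a=complex]] by blast
  define R where "R = {w. w \<noteq> 0 \<and> ?X w = \<gamma>}"
  have good: "w \<noteq> 0" "?X w = \<gamma>" "lspeed N a b w \<noteq> 0" "lsin 1 w \<noteq> 0"
    "peval (pderiv f) (?X w) (?Y w) \<noteq> 0" "w \<notin> E" if "w \<in> R" for w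
    using that \<gamma>(1) by (auto simp: R_def B1_def B2_def)
  have card_R: "card R = 2 * Suc N"
    unfolding R_def
  proof (rule card_laurent_fibre[OF laurent_ends_lX[OF N0, of a b] Complex_end_neq_0[of N a b, OF N ab]])
    fix w assume "w \<noteq> 0" "?X w = \<gamma>"
    then have "w \<in> R" by (simp add: R_def)
    from good[OF this] show "\<exists>D. D \<noteq> 0 \<and> (?X has_field_derivative D) (at w)"
      using lX_has_derivative[OF \<open>w \<noteq> 0\<close>, of N a b]
      by (intro exI[of _ "- lspeed N a b w * lsin 1 w / (\<i> * w)"]) simp
  qed simp
  then have "finite R" by (metis card.infinite mult_is_0 nat.distinct(1) zero_neq_numeral)
  define Q where "Q = map_poly (\<lambda>c. poly (map_poly of_real c) \<gamma>) f"
  have "coeff Q (degree f) \<noteq> 0"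
    using \<gamma>(2) by (simp add: Q_def coeff_map_poly)
  then have "Q \<noteq> 0" by auto
  have "?Y ` R \<subseteq> {y. poly Q y = 0}"
  proof clarify
    fix w assume "w \<in> R"
    then show "poly Q (?Y w) = 0"
      using van[of w] good(1,2)[of w] by (simp add: Q_def peval_def)
  qed
  then have "card (?Y ` R) \<le> card {y. poly Q y = 0}"
    using poly_roots_finite[OF \<open>Q \<noteq> 0\<close>] by (intro card_mono)
  also have "\<dots> \<le> degree Q" by (rule card_poly_roots_bound[OF \<open>Q \<noteq> 0\<close>])
  also have "\<dots> \<le> degree f" unfolding Q_def by (rule map_poly_degree_leq)
  also have "\<dots> \<le> total_degree f" by (rule degree_le_total_degree)
  finally have "card (?Y ` R) \<le> total_degree f" .
  moreover have "w = v \<or> w = - v" if "w \<in> R" "v \<in> R" "?Y w = ?Y v" for w v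
    using same_point_imp_square_eq[OF van, of w v] good[OF that(1)] good[OF that(2)] that(3) by auto
  moreover have "R \<inter> E = {}" "\<forall>w\<in>R. w \<noteq> 0 \<and> ?X w = \<gamma>"
    using good(1,2,6) by blast+
  moreover have "card R = 2 * N + 2" using card_R by simp
  ultimately show ?thesis
    using \<open>finite R\<close> by (intro exI[of _ R] exI[of _ \<gamma>] conjI ballI impI) blast+
qed

text \<open>Each value of \<open>Y\<close> on the fibre comes from at most two parameters,
  \<open>v\<close> and \<open>- v\<close>, so \<open>2 * N + 2\<close> parameters give at least
  \<open>N + 1\<close> values.\<close>

lemma total_degree_ge_general:
  assumes "N \<ge> 2" "a N \<noteq> 0 \<or> b N \<noteq> 0" "irreducible f" "\<forall>(x, y)\<in>curve N a b. eval2 f x y = 0"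
  shows "N + 1 \<le> total_degree f"
proof -
  obtain R where R: "finite R" "card R = 2 * N + 2" "card (lY N a b ` R) \<le> total_degree f"
    "\<forall>w\<in>R. \<forall>v\<in>R. lY N a b w = lY N a b v \<longrightarrow> w = v \<or> w = - v"
    using generic_fibre[of N a b f, OF assms finite.emptyI] by blast
  have fib: "card {w\<in>R. lY N a b w = y} \<le> 2" if y: "y \<in> lY N a b ` R" for y
  proof -
    obtain v where "v \<in> R" "y = lY N a b v" using y by blast
    with R(4) have "{w\<in>R. lY N a b w = y} \<subseteq> {v, - v}" by blast
    then have "card {w\<in>R. lY N a b w = y} \<le> card {v, - v}" by (intro card_mono) auto
    also have "\<dots> \<le> 2" by (simp add: card_insert_if)
    finally show ?thesis .
  qed
  have "R = (\<Union>y\<in>lY N a b ` R. {w\<in>R. lY N a b w = y})" by blast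
  then have "card R \<le> (\<Sum>y\<in>lY N a b ` R. card {w\<in>R. lY N a b w = y})"
    using card_UN_le[of "lY N a b ` R" "\<lambda>y. {w\<in>R. lY N a b w = y}"] R(1) by simp
  also have "\<dots> \<le> (\<Sum>y\<in>lY N a b ` R. 2)" by (intro sum_mono fib)
  finally show ?thesis using R(2,3) by simp
qed

text \<open>When the pair is not even, only finitely many \<open>w\<close> have the same image as
  \<open>- w\<close>. With these put into \<open>E\<close>, the generic fibre avoids them and
  \<open>Y\<close> is injective on it.\<close>

lemma total_degree_ge_not_even:
  assumes "N \<ge> 2" "a N \<noteq> 0 \<or> b N \<noteq> 0" "irreducible f" "\<forall>(x, y)\<in>curve N a b. eval2 f x y = 0"
    and not_even: "\<not> (\<forall>k. 2 * k \<le> N \<longrightarrow> a (2 * k) = 0 \<and> (1 \<le> k \<longrightarrow> b (2 * k) = 0))"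
  shows "2 * N + 2 \<le> total_degree f"
proof -
  define E where "E = {w. w \<noteq> 0 \<and> lX N a b (- w) - lX N a b w = 0} \<inter> {w. w \<noteq> 0 \<and> lY N a b (- w) - lY N a b w = 0}"
  have "finite E"
  proof (rule ccontr)
    assume "infinite E"
    then have inf: "infinite {w. w \<noteq> 0 \<and> lX N a b (- w) - lX N a b w = 0}"
      "infinite {w. w \<noteq> 0 \<and> lY N a b (- w) - lY N a b w = 0}"
      unfolding E_def by auto
    have "lX N a b (- w) - lX N a b w = 0" "lY N a b (- w) - lY N a b w = 0" if "w \<noteq> 0" for w
      using laurent_eq_0I_infinite[OF laurent_diff[OF laurent_uminus_arg[OF laurent_lX] laurent_lX] inf(1) that]
        laurent_eq_0I_infinite[OF laurent_diff[OF laurent_uminus_arg[OF laurent_lY] laurent_lY] inf(2) that]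
      by auto
    with not_even lXY_even_imp_coeffs[of N a b] show False by auto
  qed
  from generic_fibre[of N a b f, OF assms(1-4) this]
  obtain R \<gamma> where R: "finite R" "card R = 2 * N + 2" "card (lY N a b ` R) \<le> total_degree f"
    "R \<inter> E = {}" "\<forall>w\<in>R. w \<noteq> 0 \<and> lX N a b w = \<gamma>"
    "\<forall>w\<in>R. \<forall>v\<in>R. lY N a b w = lY N a b v \<longrightarrow> w = v \<or> w = - v"
    by blast
  have "inj_on (lY N a b) R"
  proof (rule inj_onI, rule ccontr)
    fix w v assume wv: "w \<in> R" "v \<in> R" "lY N a b w = lY N a b v" "w \<noteq> v"
    then have "w = - v" using R(6) by blast
    \<comment> \<open>Both parameters lie on the line \<open>x = \<gamma>\<close>, so their
      \<open>X\<close> values agree as well.\<close>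
    with wv R(5) have "v \<in> E" by (auto simp: E_def)
    with wv(2) R(4) show False by blast
  qed
  then show ?thesis using R(2,3) by (simp add: card_image)
qed

theorem theorem2p5:
  fixes N :: nat and a b :: "nat \<Rightarrow> real" and f :: "real poly poly"
  assumes "N \<ge> 2"
    and "a N \<noteq> 0 \<or> b N \<noteq> 0"
    and "defining_polynomial f (curve N a b)"
  shows "(((\<exists>k. 2 * k \<le> N \<and> a (2 * k) \<noteq> 0) \<or> (\<exists>k. 2 \<le> 2 * k \<and> 2 * k \<le> N \<and> b (2 * k) \<noteq> 0))
           \<longrightarrow> total_degree f = 2 * N + 2)
       \<and> ((\<forall>k. 2 * k \<le> N \<longrightarrow> a (2 * k) = 0 \<and> (1 \<le> k \<longrightarrow> b (2 * k) = 0))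
           \<longrightarrow> total_degree f = N + 1)"
proof -
  have irr: "irreducible f" and zeros: "{(x, y). eval2 f x y = 0} = zariski_closure (curve N a b)"
    using assms(3) by (auto simp: defining_polynomial_def)
  have "curve N a b \<subseteq> zariski_closure (curve N a b)"
    by (auto simp: zariski_closure_def)
  then have van: "\<forall>(x, y)\<in>curve N a b. eval2 f x y = 0"
    using zeros by blast
  note facts = assms(1,2) irr van
  show ?thesis
  proof (intro conjI impI)
    assume "(\<exists>k. 2 * k \<le> N \<and> a (2 * k) \<noteq> 0) \<or> (\<exists>k. 2 \<le> 2 * k \<and> 2 * k \<le> N \<and> b (2 * k) \<noteq> 0)"
    then have "\<not> (\<forall>k. 2 * k \<le> N \<longrightarrow> a (2 * k) = 0 \<and> (1 \<le> k \<longrightarrow> b (2 * k) = 0))"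
      by auto
    then show "total_degree f = 2 * N + 2"
      using total_degree_le_general[of N a b f, OF facts] total_degree_ge_not_even[of N a b f, OF facts] by simp
  next
    assume "\<forall>k. 2 * k \<le> N \<longrightarrow> a (2 * k) = 0 \<and> (1 \<le> k \<longrightarrow> b (2 * k) = 0)"
    then show "total_degree f = N + 1"
      using total_degree_le_even[of N a b f, OF facts] total_degree_ge_general[of N a b f, OF facts] by simp
  qed
qed

end
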